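(* (Fast regime.) Let $\alpha>1$, let $\rho(t):=\frac{\mathbb{E}\Lambda}{\mu}(1-e^{-\mu t})$ and let $a>\rho(t)$. With $M^{(N)}(t)$ the queue length at time $t$ in the $N$-scaled system defined in the context, $$\lim_{N\to\infty}\frac1N\log\mathbb{P}\Big(\frac{M^{(N)}(t)}{N}\ge a\Big)=a\log\Big(\frac{\rho(t)}{a}\Big)-\rho(t)+a .$$
   Context: Let $\Delta>0$, $\mu>0$, $t>0$. $\Lambda$ is a non-negative random variable with a density and finite first two moments; $\Lambda_0,\Lambda_1,\dots$ are i.i.d. copies of $\Lambda$. Define $$\Lambda^{(N)}(s):=\sum_{j=0}^\infty \Lambda_j\,1_{[j\Delta N^{-\alpha},(j+1)\Delta N^{-\alpha})}(s),\qquad \kappa_t(\Lambda^{(N)}):=\int_0^t\Lambda^{(N)}(s)\,e^{-\mu s}\,\mathrm{d}s .$$ $M^{(N)}(t)$ is the number of jobs at time $t$ in an initially empty infinite-server queue with i.i.d. exponential service times of mean $1/\mu$ (independent of the arrivals) and random arrival rate $N\Lambda^{(N)}(\cdot)$; it is a mixed Poisson random variable with random parameter distributed as $N\kappa_t(\Lambda^{(N)})$.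
   Formalization: Two finite moments of Λ are not enough (polynomial tails make the probability decay only polynomially); the added assumption is that E exp(θΛ^{1/α}) is finite for every θ>0, which holds whenever Λ has some finite exponential moment. *)

theory Defs
  imports "HOL-Probability.Probability"
begin

(* A sample path of the resampled rate: the i.i.d. values lam j are held constant on
   consecutive slots of length Delta N^(-alpha).  The series has at most one nonzero term. *)
definition resampled_rate ::
  "real \<Rightarrow> real \<Rightarrow> nat \<Rightarrow> (nat \<Rightarrow> real) \<Rightarrow> real \<Rightarrow> real" where
  "resampled_rate \<Delta> \<alpha> N lam s =
     (\<Sum>j. lam j * indicator {real j * \<Delta> * real N powr (- \<alpha>) ..<
                           (real j + 1) * \<Delta> * real N powr (- \<alpha>)} s)"

definition kappa :: "real \<Rightarrow> real \<Rightarrow> (real \<Rightarrow> real) \<Rightarrow> real" where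
  "kappa \<mu> t r = (LBINT s:{0..t}. r s * exp (- \<mu> * s))"

(* Arrivals with rate function r are a unit-rate Poisson process, given by its gaps xi,
   run on the clock s |-> integral of r over [0, s].  With a random r independent of xi this
   is the Poisson process with random rate r (Cox process).
   Inf is only meant for a nonempty set; the total rate is almost surely infinite below. *)
definition arrival_time :: "(real \<Rightarrow> real) \<Rightarrow> (nat \<Rightarrow> real) \<Rightarrow> nat \<Rightarrow> real" where
  "arrival_time r \<xi> i = Inf {s. 0 \<le> s \<and> (\<Sum>k\<le>i. \<xi> k) \<le> (LBINT u:{0..s}. r u)}"

(* Infinitely many servers, no jobs at time 0: job i occupies a server from its arrival until
   its service requirement S i has elapsed.  The set is almost surely finite below. *)
definition queue_length ::
  "(real \<Rightarrow> real) \<Rightarrow> (nat \<Rightarrow> real) \<Rightarrow> (nat \<Rightarrow> real) \<Rightarrow> real \<Rightarrow> nat" where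
  "queue_length r \<xi> S t =
     card {i. arrival_time r \<xi> i \<le> t \<and> t < arrival_time r \<xi> i + S i}"

(* X has the mixed Poisson law whose random parameter is distributed as K. *)
definition mixed_poisson :: "'a measure \<Rightarrow> ('a \<Rightarrow> nat) \<Rightarrow> ('a \<Rightarrow> real) \<Rightarrow> bool" where
  "mixed_poisson P X K \<longleftrightarrow>
     X \<in> measurable P (count_space UNIV) \<and>
     (\<forall>k. \<P>(\<omega> in P. X \<omega> = k) = (LINT \<omega>|P. exp (- K \<omega>) * K \<omega> ^ k / fact k))"

definition rho :: "real \<Rightarrow> real \<Rightarrow> real \<Rightarrow> real" where
  "rho m \<mu> t = m / \<mu> * (1 - exp (- \<mu> * t))"

end

theory Submission
  imports Defs
begin

text \<open>In the fast regime the environment averages out. Given the rates, the queue length at time \<open>t\<close> is Poisson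
with parameter \<open>N\<close> times a weighted sum of the i.i.d. rates, with about \<open>N^\<alpha>\<close> weights, each at most of order
\<open>N^{-\<alpha>}\<close> and of fixed total \<open>(1 - e^{-\<mu>t}) / \<mu>\<close>. For \<open>\<alpha> > 1\<close> this sum concentrates so strongly around
\<open>\<rho>\<close> that deviations of the environment are negligible on the exponential scale, and the decay rate is that
of a Poisson variable with the deterministic parameter \<open>N\<rho>\<close>.

The law given the rates (\<open>queue_length_poisson\<close>) comes from thinning: on the clock that integrates the
arrival rate, arrivals are a unit-rate Poisson process and a job is still in service at time \<open>t\<close> with a
probability depending only on its epoch (\<open>marked_arrivals_poisson\<close>). Mixing over the independent
environment makes the queue length mixed Poisson (\<open>queue_length_mixed_poisson\<close>).

For the upper bound of the limit (\<open>mixed_poisson_upper_bound\<close>) a Chernoff bound reduces the problem to an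
exponential moment of the environment of order \<open>N\<close>. The rates need not have exponential moments; they are
truncated at \<open>N^\<alpha>\<close>. A rate above this level has probability below \<open>e^{-\<theta>N}\<close> up to a constant, for every
\<open>\<theta>\<close>, and the truncated moment is at most \<open>exp (N s \<rho> + O(N^{2-\<alpha>}))\<close> (\<open>truncated_mgf\<close>). For the lower bound
(\<open>mixed_poisson_lower_bound\<close>) Chebyshev's inequality keeps the environment near its mean and a single Poisson
weight is estimated. Both apply to any weights of this kind (\<open>slot_weight_ldp\<close>), hence to the queue itself
and to every variable that is mixed Poisson with parameter \<open>N \<kappa>\<close>.\<close>

section \<open>Independent thinning of a Poisson process\<close>

text \<open>Given the environment, the arrivals form an inhomogeneous Poisson process and each arrival is still in
service at time \<open>t\<close> independently with a probability that depends only on its epoch. On the arrival clock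
this is an independent thinning of a unit-rate Poisson process. For \<open>k \<le> n\<close> the event that, starting
from clock time \<open>x\<close>, exactly \<open>n\<close> arrivals occur up to \<open>T\<close> and exactly \<open>k\<close> of them are retained has probability
\<open>e^{-(T-x)} U(x)^k / k! * (T-x-U(x))^{n-k} / (n-k)!\<close>, where \<open>U(x)\<close> is the integral of the retention
probability over \<open>[x, T]\<close>. This follows by induction on \<open>n\<close>, conditioning on the first gap and mark.

The recursion below is that event written so that the first gap and mark can be split off. Negative gaps
are excluded explicitly, so that the induction never leaves \<open>0 \<le> x \<le> T\<close>.\<close>

primrec thinned_path ::
  "(real \<Rightarrow> 'm \<Rightarrow> bool) \<Rightarrow> real \<Rightarrow> nat \<Rightarrow> nat \<Rightarrow> real \<Rightarrow> (nat \<Rightarrow> real \<times> 'm) \<Rightarrow> bool" where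
  "thinned_path C T 0 k x \<omega> \<longleftrightarrow> k = 0 \<and> T < x + fst (\<omega> 0)"
| "thinned_path C T (Suc n) k x \<omega> \<longleftrightarrow> 0 \<le> fst (\<omega> 0) \<and> x + fst (\<omega> 0) \<le> T \<and>
     (if C (x + fst (\<omega> 0)) (snd (\<omega> 0))
      then 0 < k \<and> thinned_path C T n (k - 1) (x + fst (\<omega> 0)) (\<lambda>i. \<omega> (Suc i))
      else thinned_path C T n k (x + fst (\<omega> 0)) (\<lambda>i. \<omega> (Suc i)))"

definition arrivals :: "real \<Rightarrow> real \<Rightarrow> (nat \<Rightarrow> real \<times> 'm) \<Rightarrow> nat set" where
  "arrivals T x \<omega> = {i. x + (\<Sum>j\<le>i. fst (\<omega> j)) \<le> T}"

definition marked_arrivals ::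
  "(real \<Rightarrow> 'm \<Rightarrow> bool) \<Rightarrow> real \<Rightarrow> real \<Rightarrow> (nat \<Rightarrow> real \<times> 'm) \<Rightarrow> nat set" where
  "marked_arrivals C T x \<omega> =
     {i. x + (\<Sum>j\<le>i. fst (\<omega> j)) \<le> T \<and> C (x + (\<Sum>j\<le>i. fst (\<omega> j))) (snd (\<omega> i))}"

lemma arrivals_step:
  assumes "\<And>i. 0 \<le> fst (\<omega> i)"
  shows "arrivals T x \<omega> =
    (if x + fst (\<omega> 0) \<le> T
     then insert 0 (Suc ` arrivals T (x + fst (\<omega> 0)) (\<lambda>i. \<omega> (Suc i))) else {})"
proof -
  have s: "fst (\<omega> 0) + (\<Sum>j\<le>i. fst (\<omega> (Suc j))) = (\<Sum>j\<le>Suc i. fst (\<omega> j))" for i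
    by (subst sum.atMost_Suc_shift) simp
  have nn: "fst (\<omega> 0) \<le> (\<Sum>j\<le>i. fst (\<omega> j))" for i
    by (rule member_le_sum) (auto simp: assms)
  show ?thesis
  proof (cases "x + fst (\<omega> 0) \<le> T")
    case True
    have "i \<in> arrivals T x \<omega> \<longleftrightarrow> i \<in> insert 0 (Suc ` arrivals T (x + fst (\<omega> 0)) (\<lambda>i. \<omega> (Suc i)))" for i
      using True by (cases i) (auto simp: arrivals_def add.assoc s simp del: sum.atMost_Suc)
    then show ?thesis using True by auto
  next
    case False
    then have "i \<notin> arrivals T x \<omega>" for i using nn[of i] by (auto simp: arrivals_def)
    then show ?thesis using False by auto
  qed
qed

lemma marked_arrivals_step:
  assumes "\<And>i. 0 \<le> fst (\<omega> i)"
  shows "marked_arrivals C T x \<omega> =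
    (if x + fst (\<omega> 0) \<le> T
     then (if C (x + fst (\<omega> 0)) (snd (\<omega> 0)) then {0} else {}) \<union>
          Suc ` marked_arrivals C T (x + fst (\<omega> 0)) (\<lambda>i. \<omega> (Suc i))
     else {})"
proof -
  have s: "fst (\<omega> 0) + (\<Sum>j\<le>i. fst (\<omega> (Suc j))) = (\<Sum>j\<le>Suc i. fst (\<omega> j))" for i
    by (subst sum.atMost_Suc_shift) simp
  have nn: "fst (\<omega> 0) \<le> (\<Sum>j\<le>i. fst (\<omega> j))" for i
    by (rule member_le_sum) (auto simp: assms)
  show ?thesis
  proof (cases "x + fst (\<omega> 0) \<le> T")
    case True
    have "i \<in> marked_arrivals C T x \<omega> \<longleftrightarrow> i \<in> (if C (x + fst (\<omega> 0)) (snd (\<omega> 0)) then {0} else {}) \<union>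
          Suc ` marked_arrivals C T (x + fst (\<omega> 0)) (\<lambda>i. \<omega> (Suc i))" for i
      using True by (cases i) (auto simp: marked_arrivals_def add.assoc s simp del: sum.atMost_Suc)
    then show ?thesis using True by auto
  next
    case False
    then have "i \<notin> marked_arrivals C T x \<omega>" for i using nn[of i] by (auto simp: marked_arrivals_def)
    then show ?thesis using False by auto
  qed
qed

text \<open>The events with different \<open>n\<close> or \<open>k\<close> are disjoint because each fixes both counts. This implication
suffices, because the probabilities of these events already sum to one.\<close>

lemma thinned_path_card:
  assumes "\<And>i. 0 \<le> fst (\<omega> i)" "thinned_path C T n k x \<omega>"
  shows "finite (arrivals T x \<omega>) \<and> card (arrivals T x \<omega>) = n \<and>
    finite (marked_arrivals C T x \<omega>) \<and> card (marked_arrivals C T x \<omega>) = k"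
  using assms
proof (induction n arbitrary: k x \<omega>)
  case 0
  then show ?case by (simp add: arrivals_step marked_arrivals_step)
next
  case (Suc n)
  let ?y = "x + fst (\<omega> 0)" and ?\<omega> = "\<lambda>i. \<omega> (Suc i)"
  have y: "?y \<le> T" using Suc.prems(2) by simp
  show ?case
  proof (cases "C ?y (snd (\<omega> 0))")
    case True
    then have "0 < k" "thinned_path C T n (k - 1) ?y ?\<omega>" using Suc.prems(2) by auto
    with Suc.IH[of ?\<omega> "k - 1" ?y] Suc.prems(1) y True show ?thesis
      by (subst (1 2) arrivals_step, simp add: Suc.prems(1), simp add: Suc.prems(1),
          subst (1 2) marked_arrivals_step, simp add: Suc.prems(1), simp add: Suc.prems(1))
         (simp add: card_image card_insert_if image_iff)
  next
    case False
    then have "thinned_path C T n k ?y ?\<omega>" using Suc.prems(2) by auto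
    with Suc.IH[of ?\<omega> k ?y] Suc.prems(1) y False show ?thesis
      by (subst (1 2) arrivals_step, simp add: Suc.prems(1), simp add: Suc.prems(1),
          subst (1 2) marked_arrivals_step, simp add: Suc.prems(1), simp add: Suc.prems(1))
         (simp add: card_image card_insert_if image_iff)
  qed
qed

text \<open>Retention acts on the probabilities only through \<open>g\<close>; its continuity makes the first-gap recursion solvable
by the fundamental theorem of calculus.\<close>

locale thinned_poisson = Q: prob_space Q for Q :: "'m measure" +
  fixes C :: "real \<Rightarrow> 'm \<Rightarrow> bool" and T :: real and g :: "real \<Rightarrow> real"
  assumes C_measurable [measurable]: "Measurable.pred (borel \<Otimes>\<^sub>M Q) (\<lambda>(y, s). C y s)"
    and g_eq: "\<And>y. 0 \<le> y \<Longrightarrow> y \<le> T \<Longrightarrow> Q.prob {s \<in> space Q. C y s} = g y"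
    and g_cont: "continuous_on {0..T} g"
    and T_nonneg: "0 \<le> T"
begin

abbreviation "D \<equiv> density lborel (exponential_density 1)"
abbreviation "N \<equiv> D \<Otimes>\<^sub>M Q"

sublocale D: prob_space D by (rule prob_space_exponential_density) simp
sublocale DQ: pair_prob_space D Q ..
sublocale seq: sequence_space N ..

abbreviation "Z \<equiv> PiM UNIV (\<lambda>_::nat. N)"

lemma component_measurable [measurable]: "(\<lambda>\<omega>. \<omega> i) \<in> Z \<rightarrow>\<^sub>M borel \<Otimes>\<^sub>M Q"
proof -
  have "(\<lambda>\<omega>. \<omega> i) \<in> Z \<rightarrow>\<^sub>M N" by measurable
  also have "measurable Z N = measurable Z (borel \<Otimes>\<^sub>M Q)"
    by (intro measurable_cong_sets sets_pair_measure_cong) auto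
  finally show ?thesis .
qed

lemma shift_measurable [measurable]: "(\<lambda>\<omega> i. \<omega> (Suc i)) \<in> Z \<rightarrow>\<^sub>M Z"
  by (intro measurable_PiM_single') (auto simp: space_PiM)

lemma thinned_path_measurable [measurable]:
  "Measurable.pred (borel \<Otimes>\<^sub>M Z) (\<lambda>(x, \<omega>). thinned_path C T n k x \<omega>)"
proof (induction n arbitrary: k)
  case 0 show ?case by (simp add: split_beta')
next
  case (Suc n)
  have *: "Measurable.pred (borel \<Otimes>\<^sub>M Z)
     (\<lambda>p. thinned_path C T n k (fst p + fst (snd p 0)) (\<lambda>i. snd p (Suc i)))" for k
  proof -
    have "(\<lambda>p. (fst p + fst (snd p 0), \<lambda>i. snd p (Suc i))) \<in> borel \<Otimes>\<^sub>M Z \<rightarrow>\<^sub>M borel \<Otimes>\<^sub>M Z"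
      by measurable
    from measurable_compose[OF this Suc.IH[of k]] show ?thesis by simp
  qed
  note [measurable] = this
  have [measurable]: "Measurable.pred (borel \<Otimes>\<^sub>M Z) (\<lambda>p. C (fst p + fst (snd p 0)) (snd (snd p 0)))"
  proof -
    have "(\<lambda>p. (fst p + fst (snd p 0), snd (snd p 0))) \<in> borel \<Otimes>\<^sub>M Z \<rightarrow>\<^sub>M borel \<Otimes>\<^sub>M Q"
      by measurable
    from measurable_compose[OF this C_measurable] show ?thesis by simp
  qed
  show ?case unfolding thinned_path.simps split_beta' by measurable
qed

definition U :: "real \<Rightarrow> real" where "U x = integral {x..T} g"

lemma g_bounds: "0 \<le> y \<Longrightarrow> y \<le> T \<Longrightarrow> 0 \<le> g y \<and> g y \<le> 1"
  by (metis g_eq Q.prob_le_1 measure_nonneg)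

lemma U_bounds: assumes "0 \<le> x" "x \<le> T" shows "0 \<le> U x \<and> U x \<le> T - x"
proof -
  have i: "g integrable_on {x..T}"
    using g_cont assms by (intro integrable_continuous_real) (auto elim: continuous_on_subset)
  have "integral {x..T} g \<le> integral {x..T} (\<lambda>_. 1)"
    using g_bounds assms by (intro integral_le i) auto
  moreover have "0 \<le> integral {x..T} g"
    using g_bounds assms by (intro integral_nonneg i) auto
  ultimately show ?thesis using assms by (simp add: U_def)
qed

lemma U_deriv:
  assumes "0 \<le> x" "u \<in> {0..T - x}"
  shows "((\<lambda>u. U (x + u)) has_real_derivative - g (x + u)) (at u within {0..T - x})"
proof -
  have im: "(+) x ` {0..T - x} = {x..T}" by simp
  have "(U has_real_derivative - g (x + u)) (at (x + u) within {x..T})"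
    unfolding U_def using assms g_cont
    by (intro integral_has_real_derivative') (auto elim: continuous_on_subset)
  then have "(U \<circ> (+) x has_real_derivative - g (x + u) * 1) (at u within {0..T - x})"
    by (intro DERIV_image_chain) (auto simp: im intro!: derivative_eq_intros)
  then show ?thesis by (simp add: o_def)
qed

definition path_prob :: "nat \<Rightarrow> nat \<Rightarrow> real \<Rightarrow> real" where
  "path_prob n k x = (if k \<le> n then exp (- (T - x)) *
     (U x ^ k / fact k * ((T - x - U x) ^ (n - k) / fact (n - k))) else 0)"

lemma path_prob_nonneg: "0 \<le> x \<Longrightarrow> x \<le> T \<Longrightarrow> 0 \<le> path_prob n k x"
  using U_bounds[of x] by (simp add: path_prob_def)

lemma power_over_fact_deriv:
  "((\<lambda>v. v ^ j / fact j) has_real_derivative (if j = 0 then 0 else v ^ (j - 1) / fact (j - 1))) (at v within A)"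
proof (cases j)
  case (Suc i)
  have "((\<lambda>v. v ^ Suc i / fact (Suc i)) has_real_derivative (real (Suc i) * v ^ i) / fact (Suc i)) (at v within A)"
    by (rule derivative_eq_intros refl)+ auto
  moreover have "(real (Suc i) * v ^ i) / fact (Suc i) = v ^ i / fact i"
    by (simp only: fact_Suc of_nat_mult) simp
  ultimately show ?thesis using Suc by simp
qed simp

text \<open>Up to the factor \<open>e^{-(T-x)}\<close> the right-hand side of the recursion is a total derivative, because
\<open>U' = -g\<close> and \<open>(T - x - U)' = -(1 - g)\<close>.\<close>

lemma path_prob_integral:
  assumes x: "0 \<le> x" "x \<le> T"
  shows "((\<lambda>u. exp (- u) * (g (x + u) * (if 0 < k then path_prob n (k - 1) (x + u) else 0) +
            (1 - g (x + u)) * path_prob n k (x + u))) has_integral path_prob (Suc n) k x) {0..T - x}"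
proof (cases "k \<le> Suc n")
  case False
  then have "\<not> k - 1 \<le> n" "\<not> k \<le> n" by auto
  then show ?thesis using False by (simp add: path_prob_def)
next
  case True
  define m where "m = Suc n - k"
  let ?V = "\<lambda>u. U (x + u)" and ?W = "\<lambda>u. T - (x + u) - U (x + u)"
  let ?F = "\<lambda>u. - (exp (- (T - x)) * (?V u ^ k / fact k * (?W u ^ m / fact m)))"
  let ?d = "\<lambda>j v. if j = 0 then 0 else v ^ (j - 1) / fact (j - 1) :: real"
  let ?f = "\<lambda>u. exp (- (T - x)) * (g (x + u) * ?d k (?V u) * (?W u ^ m / fact m) +
      (1 - g (x + u)) * (?V u ^ k / fact k) * ?d m (?W u))"
  have I: "(?f has_integral ?F (T - x) - ?F 0) {0..T - x}"
  proof (rule fundamental_theorem_of_calculus)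
    fix u assume u: "u \<in> {0..T - x}"
    have V: "(?V has_real_derivative - g (x + u)) (at u within {0..T - x})"
      by (rule U_deriv[OF x(1) u])
    have W: "(?W has_real_derivative - (1 - g (x + u))) (at u within {0..T - x})"
      by (rule derivative_eq_intros V refl)+ simp
    note V' = DERIV_chain2[OF power_over_fact_deriv V, of k]
    note W' = DERIV_chain2[OF power_over_fact_deriv W, of m]
    have "(?F has_real_derivative
        - (exp (- (T - x)) * ((?V u ^ k / fact k) * (?d m (?W u) * - (1 - g (x + u)))
          + (?d k (?V u) * - g (x + u)) * (?W u ^ m / fact m)))) (at u within {0..T - x})"
      using DERIV_minus[OF DERIV_cmult[OF DERIV_mult'[OF V' W'], of "exp (- (T - x))"]] by simp
    also have "- (exp (- (T - x)) * ((?V u ^ k / fact k) * (?d m (?W u) * - (1 - g (x + u)))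
          + (?d k (?V u) * - g (x + u)) * (?W u ^ m / fact m))) = ?f u"
      by (simp add: algebra_simps diff_divide_distrib)
    finally show "(?F has_vector_derivative ?f u) (at u within {0..T - x})"
      by (simp only: has_real_derivative_iff_has_vector_derivative)
  qed (use x in simp)
  \<comment> \<open>one of the two powers is positive because k + m = Suc n, and both bases vanish at T\<close>
  have at_end: "?F (T - x) = 0"
  proof -
    have "U T = 0" by (simp add: U_def)
    moreover have "k \<noteq> 0 \<or> m \<noteq> 0" by (auto simp: m_def)
    ultimately show ?thesis by auto
  qed
  have start: "- ?F 0 = path_prob (Suc n) k x"
    using True by (simp add: path_prob_def m_def)
  have f_eq: "?f u = exp (- u) * (g (x + u) * (if 0 < k then path_prob n (k - 1) (x + u) else 0) +
            (1 - g (x + u)) * path_prob n k (x + u))" for u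
  proof -
    have e: "exp (- (T - x)) = exp (- u) * exp (- (T - (x + u)))"
      by (simp add: exp_add[symmetric])
    have 1: "exp (- (T - (x + u))) * (?d k (?V u) * (?W u ^ m / fact m)) =
        (if 0 < k then path_prob n (k - 1) (x + u) else 0)"
      using True by (auto simp: path_prob_def m_def Suc_diff_le)
    have 2: "exp (- (T - (x + u))) * ((?V u ^ k / fact k) * ?d m (?W u)) = path_prob n k (x + u)"
      using True by (auto simp: path_prob_def m_def Suc_diff_le)
    show ?thesis unfolding 1[symmetric] 2[symmetric] e by (simp only: algebra_simps)
  qed
  show ?thesis
    using I unfolding f_eq at_end diff_0 start .
qed

text \<open>An i.i.d. sequence is its first entry followed by an independent copy of the sequence; this is what
makes the first-gap recursion an integral equation.\<close>

lemma nn_integral_Z: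
  assumes [measurable]: "f \<in> borel_measurable Z"
  shows "(\<integral>\<^sup>+\<omega>. f \<omega> \<partial>Z) = (\<integral>\<^sup>+u. ennreal (exponential_density 1 u) *
     (\<integral>\<^sup>+s. (\<integral>\<^sup>+\<omega>. f (case_nat (u, s) \<omega>) \<partial>Z) \<partial>Q) \<partial>lborel)"
proof -
  have "(\<integral>\<^sup>+\<omega>. f \<omega> \<partial>Z) = (\<integral>\<^sup>+\<omega>. f \<omega> \<partial>distr (N \<Otimes>\<^sub>M Z) Z (\<lambda>(s, \<omega>). case_nat s \<omega>))"
    by (simp only: seq.PiM_iter)
  also have "\<dots> = (\<integral>\<^sup>+p. f (case_nat (fst p) (snd p)) \<partial>(N \<Otimes>\<^sub>M Z))"
    by (subst nn_integral_distr) (auto simp: split_beta')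
  also have "\<dots> = (\<integral>\<^sup>+n. (\<integral>\<^sup>+\<omega>. f (case_nat n \<omega>) \<partial>Z) \<partial>N)"
    by (subst seq.P.nn_integral_fst[symmetric]) auto
  also have "\<dots> = (\<integral>\<^sup>+u. (\<integral>\<^sup>+s. (\<integral>\<^sup>+\<omega>. f (case_nat (u, s) \<omega>) \<partial>Z) \<partial>Q) \<partial>D)"
    by (subst Q.nn_integral_fst[symmetric]) auto
  also have "\<dots> = (\<integral>\<^sup>+u. ennreal (exponential_density 1 u) *
     (\<integral>\<^sup>+s. (\<integral>\<^sup>+\<omega>. f (case_nat (u, s) \<omega>) \<partial>Z) \<partial>Q) \<partial>lborel)"
    by (subst nn_integral_density) auto
  finally show ?thesis .
qed

lemma emeasure_Z:
  assumes [measurable]: "Measurable.pred Z P"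
  shows "emeasure Z {\<omega> \<in> space Z. P \<omega>} = (\<integral>\<^sup>+u. ennreal (exponential_density 1 u) *
     (\<integral>\<^sup>+s. emeasure Z {\<omega> \<in> space Z. P (case_nat (u, s) \<omega>)} \<partial>Q) \<partial>lborel)"
proof -
  have "emeasure Z {\<omega> \<in> space Z. P \<omega>} = (\<integral>\<^sup>+\<omega>. indicator {\<omega> \<in> space Z. P \<omega>} \<omega> \<partial>Z)"
    by (subst nn_integral_indicator) auto
  also have "\<dots> = (\<integral>\<^sup>+u. ennreal (exponential_density 1 u) *
     (\<integral>\<^sup>+s. (\<integral>\<^sup>+\<omega>. indicator {\<omega> \<in> space Z. P \<omega>} (case_nat (u, s) \<omega>) \<partial>Z) \<partial>Q) \<partial>lborel)"
    by (rule nn_integral_Z) measurable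
  also have "\<dots> = (\<integral>\<^sup>+u. ennreal (exponential_density 1 u) *
     (\<integral>\<^sup>+s. emeasure Z {\<omega> \<in> space Z. P (case_nat (u, s) \<omega>)} \<partial>Q) \<partial>lborel)"
  proof (intro nn_integral_cong arg_cong2[where f = "(*)"] refl)
    fix u :: real and s assume s: "s \<in> space Q"
    have c: "case_nat (u, s) \<in> Z \<rightarrow>\<^sub>M Z"
    proof (rule measurable_case_nat')
      show "(\<lambda>_. (u, s)) \<in> Z \<rightarrow>\<^sub>M N"
        by (rule measurable_const) (use s in \<open>simp add: space_pair_measure\<close>)
      show "(\<lambda>\<omega>. \<omega>) \<in> Z \<rightarrow>\<^sub>M Z" by (rule measurable_ident_sets) (rule refl)
    qed
    have Pc: "Measurable.pred Z (\<lambda>\<omega>. P (case_nat (u, s) \<omega>))"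
      by (rule measurable_compose[OF c assms])
    have "(\<integral>\<^sup>+\<omega>. indicator {\<omega> \<in> space Z. P \<omega>} (case_nat (u, s) \<omega>) \<partial>Z)
        = (\<integral>\<^sup>+\<omega>. indicator {\<omega> \<in> space Z. P (case_nat (u, s) \<omega>)} \<omega> \<partial>Z)"
    proof (rule nn_integral_cong)
      fix \<omega> assume "\<omega> \<in> space Z"
      with measurable_space[OF c this]
      show "indicator {\<omega> \<in> space Z. P \<omega>} (case_nat (u, s) \<omega>)
          = (indicator {\<omega> \<in> space Z. P (case_nat (u, s) \<omega>)} \<omega> :: ennreal)"
        unfolding indicator_def mem_Collect_eq by simp
    qed
    also have "\<dots> = emeasure Z {\<omega> \<in> space Z. P (case_nat (u, s) \<omega>)}"
      by (rule nn_integral_indicator) (rule predE[OF Pc])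
    finally show "(\<integral>\<^sup>+\<omega>. indicator {\<omega> \<in> space Z. P \<omega>} (case_nat (u, s) \<omega>) \<partial>Z)
        = emeasure Z {\<omega> \<in> space Z. P (case_nat (u, s) \<omega>)}" .
  qed
  finally show ?thesis .
qed

lemma thinned_path_pred [measurable]: "Measurable.pred Z (\<lambda>\<omega>. thinned_path C T n k x \<omega>)"
  using measurable_compose[OF measurable_Pair1' thinned_path_measurable, of x n k] by simp

lemma thinned_path_emeasure:
  assumes "0 \<le> x" "x \<le> T"
  shows "emeasure Z {\<omega> \<in> space Z. thinned_path C T n k x \<omega>} = ennreal (path_prob n k x)"
  using assms
proof (induction n arbitrary: k x)
  case 0
  have "emeasure Z {\<omega> \<in> space Z. thinned_path C T 0 k x \<omega>} =
     (\<integral>\<^sup>+u. ennreal (exponential_density 1 u) *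
     (\<integral>\<^sup>+s. emeasure Z {\<omega> \<in> space Z. k = 0 \<and> T < x + u} \<partial>Q) \<partial>lborel)"
    by (subst emeasure_Z[OF thinned_path_pred]) simp
  also have "\<dots> = (\<integral>\<^sup>+u. ennreal (exponential_density 1 u) *
      (if k = 0 then indicator {T - x<..} u else 0) \<partial>lborel)"
    by (intro nn_integral_cong arg_cong2[where f = "(*)"] refl)
       (auto simp: seq.P.emeasure_space_1 Q.emeasure_space_1 indicator_def)
  also have "\<dots> = (if k = 0 then emeasure D {T - x<..} else 0)"
    by (simp add: emeasure_density)
  also have "emeasure D {T - x<..} = ennreal (exp (- (T - x)))"
  proof -
    have "distributed D lborel (\<lambda>x. x) (exponential_density 1)"
      by (simp add: distributed_def distr_id2)
    from D.exponential_distributedD_gt[OF this, of "T - x"] 0 show ?thesis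
      by (simp add: D.emeasure_eq_measure greaterThan_def)
  qed
  finally show ?case by (auto simp: path_prob_def)
next
  case (Suc n)
  let ?A = "\<lambda>y. if 0 < k then path_prob n (k - 1) y else 0"
  have inner: "(\<integral>\<^sup>+s. emeasure Z {\<omega> \<in> space Z. thinned_path C T (Suc n) k x (case_nat (u, s) \<omega>)} \<partial>Q)
      = ennreal (g (x + u) * ?A (x + u) + (1 - g (x + u)) * path_prob n k (x + u)) * indicator {0..T - x} u" for u
  proof (cases "u \<in> {0..T - x}")
    case False
    then show ?thesis by (auto simp: not_le)
  next
    case True
    let ?y = "x + u" and ?S = "{s \<in> space Q. C (x + u) s}"
    have y: "0 \<le> ?y" "?y \<le> T" using True Suc.prems by auto
    have [measurable]: "Measurable.pred Q (\<lambda>s. C ?y s)"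
      using measurable_compose[OF measurable_Pair1' C_measurable, of ?y] by simp
    have A: "0 \<le> ?A ?y" and B: "0 \<le> path_prob n k ?y" using y path_prob_nonneg by auto
    have S: "emeasure Q ?S = ennreal (g ?y)"
      using g_eq[OF y] by (simp add: Q.emeasure_eq_measure)
    have S': "emeasure Q (space Q - ?S) = ennreal (1 - g ?y)"
      using g_eq[OF y] Q.prob_compl[of ?S] by (simp add: Q.emeasure_eq_measure)
    have "(\<integral>\<^sup>+s. emeasure Z {\<omega> \<in> space Z. thinned_path C T (Suc n) k x (case_nat (u, s) \<omega>)} \<partial>Q)
      = (\<integral>\<^sup>+s. ennreal (?A ?y) * indicator ?S s + ennreal (path_prob n k ?y) * indicator (space Q - ?S) s \<partial>Q)"
    proof (rule nn_integral_cong)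
      fix s assume s: "s \<in> space Q"
      show "emeasure Z {\<omega> \<in> space Z. thinned_path C T (Suc n) k x (case_nat (u, s) \<omega>)}
        = ennreal (?A ?y) * indicator ?S s + ennreal (path_prob n k ?y) * indicator (space Q - ?S) s"
        using True s y Suc.IH[OF y, of "k - 1"] Suc.IH[OF y, of k]
        by (cases "C ?y s") (auto simp: indicator_def)
    qed
    also have "\<dots> = ennreal (?A ?y) * ennreal (g ?y) + ennreal (path_prob n k ?y) * ennreal (1 - g ?y)"
      by (subst nn_integral_add) (auto simp: nn_integral_cmult_indicator S S')
    also have "\<dots> = ennreal (g ?y * ?A ?y + (1 - g ?y) * path_prob n k ?y)"
      using A B g_bounds[OF y] by (simp add: ennreal_mult[symmetric] ennreal_plus[symmetric] mult.commute
          del: ennreal_plus)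
    finally show ?thesis using True by simp
  qed
  have "emeasure Z {\<omega> \<in> space Z. thinned_path C T (Suc n) k x \<omega>} =
     (\<integral>\<^sup>+u. ennreal (exp (- u) * (g (x + u) * ?A (x + u) + (1 - g (x + u)) * path_prob n k (x + u)))
        * indicator {0..T - x} u \<partial>lborel)"
    by (subst emeasure_Z[OF thinned_path_pred], subst inner)
       (auto intro!: nn_integral_cong simp: exponential_density_def ennreal_mult' indicator_def)
  also have "\<dots> = ennreal (path_prob (Suc n) k x)"
  proof (rule nn_integral_has_integral_lebesgue'[OF _ path_prob_integral[OF Suc.prems]])
    fix u assume "u \<in> {0..T - x}"
    then have y: "0 \<le> x + u" "x + u \<le> T" using Suc.prems by auto
    show "0 \<le> exp (- u) * (g (x + u) * ?A (x + u) + (1 - g (x + u)) * path_prob n k (x + u))"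
      using path_prob_nonneg[OF y] g_bounds[OF y] by auto
  qed
  finally show ?case .
qed

lemma AE_gaps_nonneg: "AE \<omega> in Z. \<forall>i. 0 \<le> fst (\<omega> i)"
proof -
  have D: "AE u in D. 0 \<le> u"
    by (subst AE_density) (simp_all add: exponential_density_def)
  have fst_m: "fst \<in> N \<rightarrow>\<^sub>M borel"
    by (rule measurable_compose[OF measurable_fst measurable_ident_sets]) simp
  have "AE p in N. 0 \<le> fst p"
  proof (rule DQ.AE_pair_measure)
    show "{p \<in> space N. 0 \<le> fst p} \<in> sets N"
      by (rule predE, rule measurable_compose[OF fst_m]) measurable
    show "AE u in D. AE s in Q. 0 \<le> fst (u, s)"
      using D by eventually_elim simp
  qed
  then have "AE \<omega> in Z. 0 \<le> fst (\<omega> i)" for i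
    by (rule AE_PiM_component[where P = "\<lambda>p. 0 \<le> fst p", OF DQ.P.prob_space_axioms UNIV_I])
  then show ?thesis by (simp add: AE_all_countable)
qed

lemma marked_arrivals_measurable [measurable]:
  "(\<lambda>\<omega>. card (marked_arrivals C T 0 \<omega>)) \<in> Z \<rightarrow>\<^sub>M count_space UNIV"
proof -
  have [measurable]: "Measurable.pred Z (\<lambda>\<omega>. C (0 + (\<Sum>j\<le>i. fst (\<omega> j))) (snd (\<omega> i)))" for i
  proof -
    have "(\<lambda>\<omega>. (0 + (\<Sum>j\<le>i. fst (\<omega> j)), snd (\<omega> i))) \<in> Z \<rightarrow>\<^sub>M borel \<Otimes>\<^sub>M Q"
      by measurable
    from measurable_compose[OF this C_measurable] show ?thesis by simp
  qed
  show ?thesis unfolding marked_arrivals_def by measurable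
qed

lemma path_prob_sums: "(\<lambda>n. path_prob n k 0) sums (exp (- U 0) * U 0 ^ k / fact k)"
proof -
  have "(\<lambda>m. exp (- T) * (U 0 ^ k / fact k) * ((T - U 0) ^ m /\<^sub>R fact m))
     sums (exp (- T) * (U 0 ^ k / fact k) * exp (T - U 0))"
    by (intro sums_mult exp_converges)
  also have "(\<lambda>m. exp (- T) * (U 0 ^ k / fact k) * ((T - U 0) ^ m /\<^sub>R fact m)) = (\<lambda>m. path_prob (m + k) k 0)"
    by (auto simp: path_prob_def divide_inverse)
  also have "exp (- T) * (U 0 ^ k / fact k) * exp (T - U 0) = exp (- U 0) * U 0 ^ k / fact k"
    by (simp add: exp_diff exp_minus field_simps)
  finally show ?thesis
    by (rule sums_zero_iff_shift[THEN iffD1, rotated]) (auto simp: path_prob_def)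
qed

text \<open>Summing the path probabilities over the number \<open>n\<close> of arrivals gives a Poisson weight as a lower bound.
Paths with infinitely many arrivals are not covered by any of these events; the next theorem shows that
they do not matter, since both families of weights sum to one.\<close>

lemma marked_arrivals_ge:
  "exp (- U 0) * U 0 ^ k / fact k \<le> seq.P.prob {\<omega> \<in> space Z. card (marked_arrivals C T 0 \<omega>) = k}"
proof -
  let ?E = "\<lambda>n. {\<omega> \<in> space Z. (\<forall>i. 0 \<le> fst (\<omega> i)) \<and> thinned_path C T n k 0 \<omega>}"
  have p: "seq.P.prob (?E n) = path_prob n k 0" for n
  proof -
    have "seq.P.prob (?E n) = seq.P.prob {\<omega> \<in> space Z. thinned_path C T n k 0 \<omega>}"
      using AE_gaps_nonneg by (intro seq.P.finite_measure_eq_AE) auto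
    then show ?thesis
      using thinned_path_emeasure[of 0 n k] T_nonneg path_prob_nonneg[of 0 n k]
      by (simp add: measure_def)
  qed
  have "(\<lambda>n. seq.P.prob (?E n)) sums seq.P.prob (\<Union>n. ?E n)"
  proof (rule seq.P.finite_measure_UNION)
    have "card (arrivals T 0 \<omega>) = n" if "\<omega> \<in> ?E n" for n \<omega>
      using that thinned_path_card[of \<omega> C T n k 0] by simp
    then show "disjoint_family ?E"
      unfolding disjoint_family_on_def by blast
  qed auto
  then have "exp (- U 0) * U 0 ^ k / fact k = seq.P.prob (\<Union>n. ?E n)"
    using path_prob_sums[of k] by (simp add: p sums_iff)
  also have "\<dots> \<le> seq.P.prob {\<omega> \<in> space Z. card (marked_arrivals C T 0 \<omega>) = k}"
  proof (rule seq.P.finite_measure_mono)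
    have "card (marked_arrivals C T 0 \<omega>) = k" if "\<omega> \<in> ?E n" for n \<omega>
      using that thinned_path_card[of \<omega> C T n k 0] by simp
    then show "(\<Union>n. ?E n) \<subseteq> {\<omega> \<in> space Z. card (marked_arrivals C T 0 \<omega>) = k}"
      by blast
  qed measurable
  finally show ?thesis .
qed

theorem marked_arrivals_poisson:
  "seq.P.prob {\<omega> \<in> space Z. card (marked_arrivals C T 0 \<omega>) = k}
     = exp (- integral {0..T} g) * integral {0..T} g ^ k / fact k"
proof -
  let ?P = "\<lambda>k. seq.P.prob {\<omega> \<in> space Z. card (marked_arrivals C T 0 \<omega>) = k}"
  let ?p = "\<lambda>k. exp (- U 0) * U 0 ^ k / fact k"
  have "(\<lambda>k. exp (- U 0) * (U 0 ^ k /\<^sub>R fact k)) sums (exp (- U 0) * exp (U 0))"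
    by (intro sums_mult exp_converges)
  then have "?p sums 1" by (simp add: exp_minus divide_inverse mult_ac)
  moreover have "?P sums seq.P.prob (\<Union>k. {\<omega> \<in> space Z. card (marked_arrivals C T 0 \<omega>) = k})"
    by (rule seq.P.finite_measure_UNION) (auto simp: disjoint_family_on_def)
  moreover have "(\<Union>k. {\<omega> \<in> space Z. card (marked_arrivals C T 0 \<omega>) = k}) = space Z" by auto
  ultimately have "(\<lambda>k. ?P k - ?p k) sums 0"
    using sums_diff[of ?P 1 ?p 1] by (simp add: seq.P.prob_space)
  then have "\<forall>k. ?P k - ?p k = 0"
    by (subst (asm) sums_iff, intro suminf_eq_zero_iff[THEN iffD1]) (auto simp: marked_arrivals_ge)
  then show ?thesis by (simp add: U_def)
qed

end

section \<open>Integrals against the resampled rate\<close>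

definition slot :: "real \<Rightarrow> nat \<Rightarrow> real set" where
  "slot h j = {real j * h ..< (real j + 1) * h}"

lemma slot_iff: "0 < h \<Longrightarrow> 0 \<le> s \<Longrightarrow> s \<in> slot h j \<longleftrightarrow> j = nat \<lfloor>s / h\<rfloor>"
proof -
  assume h: "0 < h" and s: "0 \<le> s"
  have "s \<in> slot h j \<longleftrightarrow> real j \<le> s / h \<and> s / h < real j + 1"
    using h by (simp add: slot_def field_simps)
  also have "\<dots> \<longleftrightarrow> \<lfloor>s / h\<rfloor> = int j" by (simp add: floor_eq_iff)
  also have "\<dots> \<longleftrightarrow> j = nat \<lfloor>s / h\<rfloor>" using h s by auto
  finally show ?thesis .
qed

lemma resampled_rate_slots:
  assumes h: "0 < h" "h = \<Delta> * real N powr (- \<alpha>)" and s: "0 \<le> s" "s < real n * h"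
  shows "resampled_rate \<Delta> \<alpha> N lam s = (\<Sum>j<n. lam j * indicator (slot h j) s)"
    and "resampled_rate \<Delta> \<alpha> N lam s = lam (nat \<lfloor>s / h\<rfloor>)"
proof -
  have eq: "{real j * \<Delta> * real N powr (- \<alpha>) ..< (real j + 1) * \<Delta> * real N powr (- \<alpha>)} = slot h j" for j
    by (simp add: slot_def h mult.assoc)
  have k: "nat \<lfloor>s / h\<rfloor> < n"
  proof -
    have "s / h < real n" using h(1) s by (simp add: pos_divide_less_eq)
    then show ?thesis using h(1) s by (simp add: nat_less_iff floor_less_iff)
  qed
  show *: "resampled_rate \<Delta> \<alpha> N lam s = (\<Sum>j<n. lam j * indicator (slot h j) s)"
    unfolding resampled_rate_def eq
    by (rule suminf_finite) (use k slot_iff[OF h(1) s(1)] in auto)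
  have "(\<Sum>j<n. lam j * indicator (slot h j) s) = (\<Sum>j<n. if j = nat \<lfloor>s / h\<rfloor> then lam j else 0)"
    by (intro sum.cong refl) (auto simp: indicator_def slot_iff[OF h(1) s(1)])
  then show "resampled_rate \<Delta> \<alpha> N lam s = lam (nat \<lfloor>s / h\<rfloor>)"
    using k unfolding * by simp
qed

text \<open>An integral of the resampled rate against \<open>f\<close> is a weighted sum of the i.i.d. values with these weights. The
weights are at most the slot length and their total does not depend on the slot length, which is all that
the large deviations need to know about \<open>f\<close>.\<close>

definition slot_weight :: "real \<Rightarrow> real \<Rightarrow> (real \<Rightarrow> real) \<Rightarrow> nat \<Rightarrow> real" where
  "slot_weight h t f j = (LBINT s:{0..t} \<inter> slot h j. f s)"

lemma slot_borel [measurable]: "slot h j \<in> sets borel"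
  by (simp add: slot_def)

lemma resampled_rate_integral:
  assumes h: "0 < h" "h = \<Delta> * real N powr (- \<alpha>)" and t: "t < real n * h"
    and f: "continuous_on {0..t} f"
  shows "(LBINT s:{0..t}. resampled_rate \<Delta> \<alpha> N lam s * f s) = (\<Sum>j<n. lam j * slot_weight h t f j)"
    and "set_integrable lborel {0..t} (\<lambda>s. resampled_rate \<Delta> \<alpha> N lam s * f s)"
proof -
  have fi: "set_integrable lborel {0..t} f" by (rule borel_integrable_atLeastAtMost') (rule f)
  have i: "integrable lborel (\<lambda>s. lam j * (indicator ({0..t} \<inter> slot h j) s *\<^sub>R f s))" for j
    using set_integrable_subset[OF fi, of "{0..t} \<inter> slot h j"]
    by (intro integrable_mult_right) (auto simp: set_integrable_def)
  have eq: "indicator {0..t} s *\<^sub>R (resampled_rate \<Delta> \<alpha> N lam s * f s)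
      = (\<Sum>j<n. lam j * (indicator ({0..t} \<inter> slot h j) s *\<^sub>R f s))" for s
  proof (cases "s \<in> {0..t}")
    case True
    then have "0 \<le> s" "s < real n * h" using t by auto
    show ?thesis
      unfolding resampled_rate_slots(1)[OF h \<open>0 \<le> s\<close> \<open>s < real n * h\<close>] sum_distrib_right scaleR_sum_right
      using True by (intro sum.cong refl) (simp add: indicator_def)
  qed (simp add: indicator_inter_arith)
  show "(LBINT s:{0..t}. resampled_rate \<Delta> \<alpha> N lam s * f s) = (\<Sum>j<n. lam j * slot_weight h t f j)"
    unfolding set_lebesgue_integral_def slot_weight_def eq using i
    by (subst Bochner_Integration.integral_sum) auto
  show "set_integrable lborel {0..t} (\<lambda>s. resampled_rate \<Delta> \<alpha> N lam s * f s)"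
    unfolding set_integrable_def eq by (intro Bochner_Integration.integrable_sum i)
qed

lemma slot_weight_bounds:
  assumes h: "0 < h" and f: "continuous_on {0..t} f" "\<And>s. 0 \<le> s \<Longrightarrow> s \<le> t \<Longrightarrow> 0 \<le> f s \<and> f s \<le> 1"
  shows "0 \<le> slot_weight h t f j" "slot_weight h t f j \<le> h"
proof -
  let ?A = "{0..t} \<inter> slot h j"
  have "set_integrable lborel {0..t} f" by (rule borel_integrable_atLeastAtMost') (rule f)
  then have fi: "set_integrable lborel ?A f" by (rule set_integrable_subset) auto
  show "0 \<le> slot_weight h t f j"
    unfolding slot_weight_def set_lebesgue_integral_def
    by (rule integral_nonneg_AE) (auto simp: indicator_def f)
  have s: "emeasure lborel (slot h j) = ennreal h"
    using h by (simp add: slot_def algebra_simps)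
  have si: "integrable lborel (indicator (slot h j) :: real \<Rightarrow> real)"
    by (simp add: integrable_indicator_iff s)
  have "slot_weight h t f j \<le> (\<integral>s. indicator (slot h j) s \<partial>lborel)"
    unfolding slot_weight_def set_lebesgue_integral_def
    by (rule integral_mono[OF _ si]) (use fi f in \<open>auto simp: set_integrable_def indicator_def\<close>)
  also have "\<dots> = h" using h s by (simp add: measure_def)
  finally show "slot_weight h t f j \<le> h" .
qed

lemma slot_weight_sum:
  assumes h: "0 < h" and t: "t < real n * h" and f: "continuous_on {0..t} f"
  shows "(\<Sum>j<n. slot_weight h t f j) = (LBINT s:{0..t}. f s)"
proof -
  have 1: "(1::nat) = 1" "h = h * real 1 powr (- 1)" by simp_all
  \<comment> \<open>the constant environment 1, with h as its slot length\<close>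
  have "(\<Sum>j<n. slot_weight h t f j) = (LBINT s:{0..t}. resampled_rate h 1 1 (\<lambda>_. 1) s * f s)"
    using resampled_rate_integral(1)[OF h 1(2) t f, of "\<lambda>_. 1"] by simp
  also have "\<dots> = (LBINT s:{0..t}. f s)"
  proof (rule set_lebesgue_integral_cong)
    have "resampled_rate h 1 1 (\<lambda>_. 1) s = 1" if "0 \<le> s" "s \<le> t" for s
      by (rule resampled_rate_slots(2)[OF h 1(2), of _ n]) (use that t in auto)
    then show "\<forall>s. s \<in> {0..t} \<longrightarrow> resampled_rate h 1 1 (\<lambda>_. 1) s * f s = f s" by simp
  qed simp
  finally show ?thesis .
qed

section \<open>The queue in a fixed environment\<close>

text \<open>The integrated rate in closed form. It depends on \<open>n\<close> only for arguments beyond \<open>n h\<close>, so that every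
local property of the integrated rate can be read off from one of these piecewise linear functions.\<close>

definition clock :: "real \<Rightarrow> (nat \<Rightarrow> real) \<Rightarrow> nat \<Rightarrow> real \<Rightarrow> real" where
  "clock h lam n s = (\<Sum>j<n. lam j * max 0 (min s ((real j + 1) * h) - real j * h))"

lemma resampled_rate_clock:
  assumes h: "0 < h" "h = \<Delta> * real N powr (- \<alpha>)" and s: "0 \<le> s" "s < real n * h"
  shows "(LBINT u:{0..s}. real N * resampled_rate \<Delta> \<alpha> N lam u) = clock h (\<lambda>j. real N * lam j) n s"
proof -
  have w: "slot_weight h s (\<lambda>_. 1) j = max 0 (min s ((real j + 1) * h) - real j * h)" for j
  proof -
    have "slot_weight h s (\<lambda>_. 1) j = measure lborel ({0..s} \<inter> slot h j)"
      by (simp add: slot_weight_def set_lebesgue_integral_def)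
    also have "\<dots> = max 0 (min s ((real j + 1) * h) - real j * h)"
    proof (cases "s < (real j + 1) * h")
      case True
      have "0 \<le> real j * h" using h by simp
      with True have "{0..s} \<inter> slot h j = {real j * h..s}" by (auto simp: slot_def intro: order.trans)
      then show ?thesis using True by simp
    next
      case False
      have "0 \<le> real j * h" using h by simp
      with False have "{0..s} \<inter> slot h j = {real j * h..<(real j + 1) * h}"
        by (auto simp: slot_def intro: order.trans)
      then show ?thesis using False h by (simp add: algebra_simps)
    qed
    finally show ?thesis .
  qed
  have "(LBINT u:{0..s}. real N * resampled_rate \<Delta> \<alpha> N lam u)
      = real N * (LBINT u:{0..s}. resampled_rate \<Delta> \<alpha> N lam u * 1)"
    by simp
  also have "\<dots> = real N * (\<Sum>j<n. lam j * slot_weight h s (\<lambda>_. 1) j)"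
    by (subst resampled_rate_integral(1)[OF h s(2)]) auto
  finally show ?thesis by (simp add: clock_def w sum_distrib_left mult.assoc)
qed

lemma clock_mono: "(\<And>j. 0 \<le> lam j) \<Longrightarrow> s \<le> s' \<Longrightarrow> clock h lam n s \<le> clock h lam n s'"
  unfolding clock_def by (intro sum_mono mult_left_mono) auto

lemma clock_continuous: "continuous_on A (clock h lam n)"
  unfolding clock_def by (intro continuous_intros)

lemma clock_strict_mono:
  assumes "0 < h" "\<And>j. 0 < lam j" "0 \<le> s" "s < s'" "s' < real n * h"
  shows "clock h lam n s < clock h lam n s'"
  unfolding clock_def
proof (rule sum_strict_mono_ex1)
  show "\<forall>j\<in>{..<n}. lam j * max 0 (min s ((real j + 1) * h) - real j * h)
      \<le> lam j * max 0 (min s' ((real j + 1) * h) - real j * h)"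
    using assms by (intro ballI mult_left_mono) (auto intro: less_imp_le)
  define j where "j = nat \<lfloor>s / h\<rfloor>"
  have j: "real j * h \<le> s" "s < (real j + 1) * h"
    using slot_iff[of h s j] assms by (auto simp: j_def slot_def)
  then have "real j * h < real n * h" using assms by linarith
  then have "j < n" using assms by simp
  moreover have "lam j * max 0 (min s ((real j + 1) * h) - real j * h)
      < lam j * max 0 (min s' ((real j + 1) * h) - real j * h)"
    using assms j by (intro mult_strict_left_mono) auto
  ultimately show "\<exists>j\<in>{..<n}. lam j * max 0 (min s ((real j + 1) * h) - real j * h)
      < lam j * max 0 (min s' ((real j + 1) * h) - real j * h)" by auto
qed simp

lemma clock_deriv:
  assumes "0 < h" "s \<notin> (\<lambda>j. real j * h) ` {..n}"
  shows "(clock h lam n has_real_derivative (\<Sum>j<n. lam j * indicator (slot h j) s)) (at s within A)"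
  unfolding clock_def
proof (intro DERIV_sum DERIV_cmult)
  fix j assume j: "j \<in> {..<n}"
  have ne: "s \<noteq> real j * h" "s \<noteq> (real j + 1) * h"
    using assms(2) j by (auto simp: image_iff, metis Suc_leI add.commute atMost_iff of_nat_Suc)
  let ?f = "\<lambda>s. max 0 (min s ((real j + 1) * h) - real j * h)"
  have le: "real j * h < (real j + 1) * h" using assms by simp
  consider "s < real j * h" | "real j * h < s" "s < (real j + 1) * h" | "(real j + 1) * h < s"
    using ne by linarith
  then have "(?f has_real_derivative indicator (slot h j) s) (at s)"
  proof cases
    case 1
    have "((\<lambda>_. 0) has_real_derivative 0) (at s)" by simp
    then have "(?f has_real_derivative 0) (at s)"
      by (rule has_field_derivative_transform_within_open[of _ _ _ "{..<real j * h}"])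
         (use 1 le in \<open>auto simp: max_def min_def\<close>)
    then show ?thesis using 1 by (simp add: slot_def)
  next
    case 2
    have "((\<lambda>u. u - real j * h) has_real_derivative 1) (at s)"
      by (rule derivative_eq_intros refl)+ simp
    then have "(?f has_real_derivative 1) (at s)"
      by (rule has_field_derivative_transform_within_open[of _ _ _ "{real j * h<..<(real j + 1) * h}"])
         (use 2 le in \<open>auto simp: max_def min_def\<close>)
    then show ?thesis using 2 by (simp add: slot_def)
  next
    case 3
    have "((\<lambda>_. h) has_real_derivative 0) (at s)" by simp
    then have "(?f has_real_derivative 0) (at s)"
      by (rule has_field_derivative_transform_within_open[of _ _ _ "{(real j + 1) * h<..}"])
         (use 3 le assms in \<open>auto simp: max_def min_def algebra_simps\<close>)
    then show ?thesis using 3 by (simp add: slot_def)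
  qed
  then show "(?f has_real_derivative indicator (slot h j) s) (at s within A)"
    by (rule has_field_derivative_at_within)
qed

text \<open>\<open>A\<close> is the generalised inverse that turns epochs on the Poisson clock into arrival times. Continuity of the
clock makes the infimum attained, so that comparing \<open>A y\<close> with \<open>x\<close> becomes comparing \<open>y\<close> with \<open>R x\<close>; this
needs some \<open>s0\<close> at which the clock has reached \<open>y\<close>, as otherwise \<open>A y\<close> is the infimum of the empty set.\<close>

locale arrival_clock =
  fixes R :: "real \<Rightarrow> real"
  assumes R_cont: "continuous_on {0..} R" and R_mono: "mono_on {0..} R"
begin

definition A :: "real \<Rightarrow> real" where "A y = Inf {s. 0 \<le> s \<and> y \<le> R s}"

lemma A_le_iff:
  assumes "0 \<le> s0" "y \<le> R s0"
  shows "A y \<le> x \<longleftrightarrow> 0 \<le> x \<and> y \<le> R x"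
proof -
  let ?S = "{s. 0 \<le> s \<and> y \<le> R s}"
  have ne: "?S \<noteq> {}" using assms by auto
  have bdd: "bdd_below ?S" by (rule bdd_belowI[of _ 0]) auto
  have "?S = R -` {y..} \<inter> {0..}" by auto
  moreover have "closed (R -` {y..} \<inter> {0..})"
    by (rule continuous_on_closed_vimage[THEN iffD1, rule_format, OF _ R_cont]) auto
  ultimately have "closed ?S" by simp
  then have A: "A y \<in> ?S" unfolding A_def by (intro closed_contains_Inf ne bdd)
  show ?thesis
  proof
    assume x: "A y \<le> x"
    then have "R (A y) \<le> R x" using A by (intro mono_onD[OF R_mono]) auto
    then show "0 \<le> x \<and> y \<le> R x" using A x by auto
  next
    assume "0 \<le> x \<and> y \<le> R x"
    then show "A y \<le> x" unfolding A_def by (intro cInf_lower bdd) auto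
  qed
qed

end

text \<open>If all rates are positive and sum to infinity, \<open>A\<close> is an honest continuous inverse on \<open>[0, R t]\<close>. Both
conditions hold almost surely for the random environment: the rates have a density, and i.i.d.
positive rates have a divergent sum.\<close>

locale strict_arrival_clock = arrival_clock +
  fixes t :: real
  assumes t_nonneg: "0 \<le> t" and R0: "R 0 = 0" and R_strict: "strict_mono_on {0..t} R"
    and R_unbounded: "\<And>y. \<exists>s\<ge>0. y \<le> R s"
begin

lemma A_le: "A y \<le> x \<longleftrightarrow> 0 \<le> x \<and> y \<le> R x"
  using R_unbounded[of y] A_le_iff by blast

lemma A_R: "s \<in> {0..t} \<Longrightarrow> A (R s) = s"
proof (rule antisym)
  assume s: "s \<in> {0..t}"
  then show "A (R s) \<le> s" by (simp add: A_le)
  have A: "0 \<le> A (R s)" "R s \<le> R (A (R s))" using A_le[of "R s" "A (R s)"] by auto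
  show "s \<le> A (R s)"
  proof (rule ccontr)
    assume "\<not> s \<le> A (R s)"
    then have "R (A (R s)) < R s" using A s by (intro strict_mono_onD[OF R_strict]) auto
    then show False using A by simp
  qed
qed

lemma R_image: "R ` {0..t} = {0..R t}"
proof
  show "R ` {0..t} \<subseteq> {0..R t}"
    using mono_onD[OF R_mono] t_nonneg R0 by fastforce
  show "{0..R t} \<subseteq> R ` {0..t}"
  proof
    fix y assume "y \<in> {0..R t}"
    then have "\<exists>s\<ge>0. s \<le> t \<and> R s = y"
      using t_nonneg R0 by (intro IVT' continuous_on_subset[OF R_cont]) auto
    then show "y \<in> R ` {0..t}" by auto
  qed
qed

lemma A_continuous: "continuous_on {0..R t} A"
  using continuous_on_inv[of "{0..t}" R A] A_R R_image continuous_on_subset[OF R_cont]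
  by auto

lemma A_range: "y \<in> {0..R t} \<Longrightarrow> 0 \<le> A y \<and> A y \<le> t"
  using A_R R_image by (metis atLeastAtMost_iff imageE)

lemma A_measurable [measurable]: "A \<in> borel_measurable borel"
proof (rule borel_measurableI_le)
  fix x
  have "{y \<in> space borel. A y \<le> x} = (if 0 \<le> x then {..R x} else {})" by (auto simp: A_le)
  then show "{y \<in> space borel. A y \<le> x} \<in> sets borel" by simp
qed

text \<open>A job that arrives at clock time \<open>y\<close> is in service at time \<open>t\<close> if its service requirement exceeds
\<open>t - A y\<close>; jobs with \<open>A y > t\<close> are those beyond \<open>R t\<close> on the clock. So the queue length is a thinned count.\<close>

lemma in_service_poisson:
  fixes \<mu> :: real
  assumes \<mu>: "0 < \<mu>"
  defines "G \<equiv> integral {0..R t} (\<lambda>y. exp (- \<mu> * (t - A y)))"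
  defines "Z \<equiv> PiM (UNIV :: nat set)
    (\<lambda>_. density lborel (exponential_density 1) \<Otimes>\<^sub>M density lborel (exponential_density \<mu>))"
  shows "measure Z {z \<in> space Z. card {i. A (\<Sum>j\<le>i. fst (z j)) \<le> t
      \<and> t < A (\<Sum>j\<le>i. fst (z j)) + snd (z i)} = k} = exp (- G) * G ^ k / fact k"
proof -
  let ?Q = "density lborel (exponential_density \<mu>)"
  let ?C = "\<lambda>y s. t - A y < s"
  interpret Q: prob_space ?Q by (rule prob_space_exponential_density[OF \<mu>])
  interpret thinned_poisson ?Q ?C "R t" "\<lambda>y. exp (- \<mu> * (t - A y))"
  proof
    have "Measurable.pred (borel \<Otimes>\<^sub>M borel) (\<lambda>p. t - A (fst p) < snd p)"
      by measurable
    also have "measurable (borel \<Otimes>\<^sub>M borel) (count_space UNIV) = measurable (borel \<Otimes>\<^sub>M ?Q) (count_space (UNIV :: bool set))"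
      by (intro measurable_cong_sets sets_pair_measure_cong) auto
    finally show "Measurable.pred (borel \<Otimes>\<^sub>M ?Q) (\<lambda>(y, s). t - A y < s)"
      by (simp add: split_beta')
    show "0 \<le> R t" using mono_onD[OF R_mono, of 0 t] t_nonneg R0 by simp
    show "continuous_on {0..R t} (\<lambda>y. exp (- \<mu> * (t - A y)))"
      by (intro continuous_intros A_continuous)
    fix y assume y: "0 \<le> y" "y \<le> R t"
    have "distributed ?Q lborel (\<lambda>x. x) (exponential_density \<mu>)"
      using \<mu> by (auto simp: distributed_def distr_id2 exponential_density_nonneg)
    from Q.exponential_distributedD_gt[OF this, of "t - A y"] A_range[of y] y \<mu>
    show "Q.prob {s \<in> space ?Q. t - A y < s} = exp (- \<mu> * (t - A y))"
      by (simp add: algebra_simps)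
  qed
  have "{i. A (\<Sum>j\<le>i. fst (z j)) \<le> t \<and> t < A (\<Sum>j\<le>i. fst (z j)) + snd (z i)}
      = marked_arrivals ?C (R t) 0 z" for z :: "nat \<Rightarrow> real \<times> real"
    using t_nonneg by (auto simp: marked_arrivals_def A_le)
  then show ?thesis
    using marked_arrivals_poisson[of k] by (simp only: Z_def G_def)
qed

text \<open>Changing variables back from the clock to real time. The clock fails to be differentiable only at the
finitely many slot boundaries in \<open>F\<close>.\<close>

lemma A_substitution:
  assumes "finite F"
    and deriv: "\<And>s. s \<in> {0..t} - F \<Longrightarrow> (R has_real_derivative r s) (at s within {0..t})"
    and f: "continuous_on {0..t} f"
  shows "((\<lambda>s. r s * f s) has_integral integral {0..R t} (\<lambda>y. f (A y))) {0..t}"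
proof -
  have "((\<lambda>s. r s *\<^sub>R f (A (R s))) has_integral integral {R 0..R t} (\<lambda>y. f (A y))) {0..t}"
  proof (rule has_integral_substitution_strong[OF assms(1) t_nonneg _ _ _ _ deriv])
    show "R 0 \<le> R t" using mono_onD[OF R_mono, of 0 t] t_nonneg by simp
    show "R ` {0..t} \<subseteq> {0..R t}" using R_image by simp
    show "continuous_on {0..R t} (\<lambda>y. f (A y))"
      by (rule continuous_on_compose2[OF f A_continuous]) (use A_range in auto)
    show "continuous_on {0..t} R" by (rule continuous_on_subset[OF R_cont]) auto
  qed
  then show ?thesis
    unfolding R0 by (rule has_integral_eq[rotated]) (simp add: A_R)
qed

end

definition resampled_clock :: "real \<Rightarrow> real \<Rightarrow> nat \<Rightarrow> (nat \<Rightarrow> real) \<Rightarrow> real \<Rightarrow> real" where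
  "resampled_clock \<Delta> \<alpha> N lam s = (LBINT u:{0..s}. real N * resampled_rate \<Delta> \<alpha> N lam u)"

lemma resampled_arrival_clock:
  assumes h: "0 < h" "h = \<Delta> * real N powr (- \<alpha>)" and lam: "\<And>j. 0 \<le> lam j"
  shows "arrival_clock (resampled_clock \<Delta> \<alpha> N lam)"
proof
  let ?R = "resampled_clock \<Delta> \<alpha> N lam"
  have R: "?R s = clock h (\<lambda>j. real N * lam j) n s" if "0 \<le> s" "s < real n * h" for s n
    using resampled_rate_clock[OF h that] by (simp add: resampled_clock_def)
  have ex: "\<exists>n. s < real n * h" for s
    using reals_Archimedean3[OF h(1)] by blast
  show "continuous_on {0..} ?R"
    unfolding continuous_on_eq_continuous_within
  proof
    fix x :: real assume x: "x \<in> {0..}"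
    obtain n where n: "x + 1 < real n * h" using ex by blast
    show "continuous (at x within {0..}) ?R"
    proof (rule continuous_transform_within)
      show "continuous (at x within {0..}) (clock h (\<lambda>j. real N * lam j) n)"
        using clock_continuous[of "{0..}"] x by (auto simp: continuous_on_eq_continuous_within)
      show "clock h (\<lambda>j. real N * lam j) n s = ?R s" if "s \<in> {0..}" "dist s x < 1" for s
        using that n by (intro R[symmetric]) (auto simp: dist_real_def)
    qed (use x in auto)
  qed
  show "mono_on {0..} ?R"
  proof (rule mono_onI)
    fix s s' :: real assume s: "s \<in> {0..}" "s' \<in> {0..}" "s \<le> s'"
    obtain n where n: "s' < real n * h" using ex by blast
    show "?R s \<le> ?R s'"
      using s n lam by (subst (1 2) R[of _ n]) (auto intro!: clock_mono)
  qed
qed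

lemma arrival_time_eq:
  assumes "arrival_clock (resampled_clock \<Delta> \<alpha> N lam)"
  shows "arrival_time (\<lambda>s. real N * resampled_rate \<Delta> \<alpha> N lam s) \<xi> i
    = arrival_clock.A (resampled_clock \<Delta> \<alpha> N lam) (\<Sum>k\<le>i. \<xi> k)"
  by (simp add: arrival_time_def arrival_clock.A_def[OF assms] resampled_clock_def)

text \<open>The Poisson parameter weights the rate at time \<open>s\<close> by the probability \<open>e^{-\<mu>(t-s)}\<close> that a job arriving
then is still present. This is the time reversal of the weight \<open>e^{-\<mu>s}\<close> in \<^const>\<open>kappa\<close>; unless \<open>t\<close> is a
multiple of the slot length the two weighted sums of the i.i.d. rates need not have the same law.\<close>

lemma queue_length_poisson:
  fixes \<mu> t :: real
  assumes h: "0 < h" "h = \<Delta> * real N powr (- \<alpha>)" and N: "1 \<le> N" and \<mu>: "0 < \<mu>" and t: "0 \<le> t" "t < real n * h"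
    and lam: "\<And>j. 0 < lam j" and unbounded: "\<And>y. \<exists>n. y \<le> (\<Sum>j<n. lam j)"
  defines "G \<equiv> real N * (\<Sum>j<n. slot_weight h t (\<lambda>s. exp (- \<mu> * (t - s))) j * lam j)"
  defines "Z \<equiv> PiM (UNIV :: nat set)
    (\<lambda>_. density lborel (exponential_density 1) \<Otimes>\<^sub>M density lborel (exponential_density \<mu>))"
  shows "measure Z {z \<in> space Z. queue_length (\<lambda>s. real N * resampled_rate \<Delta> \<alpha> N lam s)
      (\<lambda>i. fst (z i)) (\<lambda>i. snd (z i)) t = k} = exp (- G) * G ^ k / fact k"
proof -
  let ?R = "resampled_clock \<Delta> \<alpha> N lam" and ?l = "\<lambda>j. real N * lam j"
  have l: "0 < ?l j" for j using lam N by simp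
  have R: "?R s = clock h ?l n s" if "0 \<le> s" "s < real n * h" for s n
    using resampled_rate_clock[OF h that] by (simp add: resampled_clock_def)
  interpret arrival_clock ?R
    using h lam by (intro resampled_arrival_clock) (auto intro: less_imp_le)
  interpret strict_arrival_clock ?R t
  proof
    show "?R 0 = 0"
      using R[of 0 n] t h by (simp add: clock_def min_def zero_le_mult_iff)
    show "strict_mono_on {0..t} ?R"
    proof (rule strict_mono_onI)
      fix s s' assume s: "s \<in> {0..t}" "s' \<in> {0..t}" "s < s'"
      show "?R s < ?R s'"
        using s t h(1) l by (subst (1 2) R[of _ n]) (auto intro!: clock_strict_mono)
    qed
    fix y
    obtain m where m: "y / (real N * h) \<le> (\<Sum>j<m. lam j)" using unbounded by blast
    have "y \<le> (\<Sum>j<m. lam j) * (real N * h)"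
      using m h(1) N by (simp add: pos_divide_le_eq)
    also have "\<dots> = (\<Sum>j<m. ?l j * max 0 (min (real m * h) ((real j + 1) * h) - real j * h))"
      unfolding sum_distrib_right
    proof (intro sum.cong refl)
      fix j assume "j \<in> {..<m}"
      then have "real j + 1 \<le> real m" by auto
      then have "(real j + 1) * h \<le> real m * h" using h(1) by (intro mult_right_mono) auto
      then have "max 0 (min (real m * h) ((real j + 1) * h) - real j * h) = h"
        using h(1) by (simp add: min_absorb2 distrib_right)
      then show "lam j * (real N * h) = ?l j * max 0 (min (real m * h) ((real j + 1) * h) - real j * h)" by simp
    qed
    also have "\<dots> \<le> clock h ?l (Suc m) (real m * h)"
      using l[of m] by (simp add: clock_def)
    also have "\<dots> = ?R (real m * h)" using h(1) by (intro R[symmetric]) auto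
    finally show "\<exists>s\<ge>0. y \<le> ?R s" using h(1) by (intro exI[of _ "real m * h"]) auto
  qed (use t in simp)
  let ?f = "\<lambda>s. exp (- \<mu> * (t - s))" and ?F = "(\<lambda>j. real j * h) ` {..n}"
  let ?r = "\<lambda>s. \<Sum>j<n. ?l j * indicator (slot h j) s"
  have f: "continuous_on {0..t} ?f" by (intro continuous_intros)
  have "((\<lambda>s. ?r s * ?f s) has_integral integral {0..?R t} (\<lambda>y. ?f (A y))) {0..t}"
  proof (rule A_substitution[OF _ _ f])
    fix s assume s: "s \<in> {0..t} - ?F"
    have "(clock h ?l n has_real_derivative ?r s) (at s within {0..t})"
      using s h(1) by (intro clock_deriv) auto
    then show "(?R has_real_derivative ?r s) (at s within {0..t})"
      by (rule has_field_derivative_transform_within[where d = 1]) (use s in \<open>auto intro!: R[symmetric] le_less_trans[OF _ t(2)]\<close>)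
  qed simp
  then have "integral {0..?R t} (\<lambda>y. ?f (A y)) = integral {0..t} (\<lambda>s. ?r s * ?f s)"
    by (simp add: integral_unique)
  also have "\<dots> = integral {0..t} (\<lambda>s. real N * (resampled_rate \<Delta> \<alpha> N lam s * ?f s))"
  proof (rule integral_cong)
    fix s assume "s \<in> {0..t}"
    then have s: "0 \<le> s" "s < real n * h" using t by auto
    show "?r s * ?f s = real N * (resampled_rate \<Delta> \<alpha> N lam s * ?f s)"
      unfolding resampled_rate_slots(1)[OF h s] by (simp only: sum_distrib_left sum_distrib_right mult.assoc)
  qed
  also have "\<dots> = real N * (LBINT s:{0..t}. resampled_rate \<Delta> \<alpha> N lam s * ?f s)"
    using set_borel_integral_eq_integral(2)[OF resampled_rate_integral(2)[OF h t(2) f, of lam]] by simp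
  also have "\<dots> = G"
    unfolding resampled_rate_integral(1)[OF h t(2) f] G_def by (simp add: mult.commute)
  finally have G: "integral {0..?R t} (\<lambda>y. ?f (A y)) = G" .
  show ?thesis
    using in_service_poisson[OF \<mu>, of k] unfolding G queue_length_def
    by (simp only: arrival_time_eq[OF arrival_clock_axioms] Z_def)
qed

section \<open>Poisson tails\<close>

text \<open>Written as a complement of a finite sum, the tail of a mixed Poisson variable is the expectation of the
tail at the random parameter by plain linearity.\<close>

definition poisson_tail :: "nat \<Rightarrow> real \<Rightarrow> real" where
  "poisson_tail m y = 1 - (\<Sum>k<m. exp (- y) * y ^ k / fact k)"

lemma poisson_tail_sums:
  "(\<lambda>k. exp (- y) * y ^ (k + m) / fact (k + m)) sums poisson_tail m y"
proof -
  have "(\<lambda>k. exp (- y) * (y ^ k /\<^sub>R fact k)) sums (exp (- y) * exp y)"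
    by (intro sums_mult exp_converges)
  then have "(\<lambda>k. exp (- y) * y ^ k / fact k) sums 1"
    by (simp add: exp_minus divide_inverse mult_ac)
  then show ?thesis
    unfolding poisson_tail_def by (rule sums_split_initial_segment)
qed

lemma poisson_tail_bounds:
  assumes "0 \<le> y"
  shows "0 \<le> poisson_tail m y" "poisson_tail m y \<le> 1"
    "exp (- y) * y ^ m / fact m \<le> poisson_tail m y"
proof -
  have nn: "0 \<le> poisson_tail m y" for m
    by (rule sums_le[OF _ sums_zero poisson_tail_sums]) (use assms in auto)
  show "0 \<le> poisson_tail m y" by (rule nn)
  show "poisson_tail m y \<le> 1"
    unfolding poisson_tail_def using assms by (simp add: sum_nonneg)
  have "poisson_tail (Suc m) y = poisson_tail m y - exp (- y) * y ^ m / fact m"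
    by (simp add: poisson_tail_def)
  with nn[of "Suc m"] show "exp (- y) * y ^ m / fact m \<le> poisson_tail m y" by simp
qed

text \<open>Each term of the tail at \<open>y\<close> is dominated by the corresponding term of the tail at the tilted parameter
\<open>e^\<theta> y\<close>, up to a common factor, and that tail is at most one.\<close>

lemma poisson_tail_chernoff:
  assumes "0 \<le> y" "0 \<le> \<theta>"
  shows "poisson_tail m y \<le> exp (- \<theta> * real m + (exp \<theta> - 1) * y)"
proof -
  let ?z = "exp \<theta> * y" and ?c = "exp (- \<theta> * real m + (exp \<theta> - 1) * y)"
  have "(\<lambda>k. ?c * (exp (- ?z) * ?z ^ (k + m) / fact (k + m))) sums (?c * poisson_tail m ?z)"
    by (intro sums_mult poisson_tail_sums)
  moreover have "exp (- y) * y ^ (k + m) / fact (k + m) \<le> ?c * (exp (- ?z) * ?z ^ (k + m) / fact (k + m))" for k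
  proof -
    have "?c * (exp (- ?z) * ?z ^ (k + m) / fact (k + m))
        = exp (- \<theta> * real m + (exp \<theta> - 1) * y - ?z) * exp \<theta> ^ (k + m) * y ^ (k + m) / fact (k + m)"
      by (simp add: exp_add exp_diff exp_minus power_mult_distrib divide_inverse)
    also have "exp (- \<theta> * real m + (exp \<theta> - 1) * y - ?z) * exp \<theta> ^ (k + m) = exp (- y + \<theta> * real k)"
      by (simp add: exp_of_nat_mult[symmetric] exp_add[symmetric] algebra_simps)
    finally have "?c * (exp (- ?z) * ?z ^ (k + m) / fact (k + m)) = exp (- y + \<theta> * real k) * y ^ (k + m) / fact (k + m)" .
    moreover have "exp (- y) \<le> exp (- y + \<theta> * real k)" using assms by simp
    ultimately show ?thesis using assms by (simp add: divide_right_mono mult_right_mono del: exp_le_cancel_iff)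
  qed
  ultimately have "poisson_tail m y \<le> ?c * poisson_tail m ?z"
    by (intro sums_le[OF _ poisson_tail_sums]) auto
  also have "\<dots> \<le> ?c * 1"
    using assms by (intro mult_left_mono poisson_tail_bounds) auto
  finally show ?thesis by simp
qed

text \<open>A crude Stirling bound: the polynomial factor is invisible on the exponential scale. The induction step
is \<open>e \<le> (1 + 1/m)^{m+1}\<close>.\<close>

lemma fact_upper_bound: "1 \<le> m \<Longrightarrow> fact m \<le> exp 1 * real m * (real m / exp 1) ^ m"
proof (induction m rule: dec_induct)
  case base show ?case by simp
next
  case (step m)
  have m: "0 < real m" using step by simp
  have "1 / (1 + real m) \<le> ln (1 + 1 / real m)"
    using ln_add_one_self_le_self2[of "- 1 / (1 + real m)"] ln_inverse[of "1 + 1 / real m"] m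
    by (simp add: field_simps)
  then have "exp 1 \<le> exp (real (Suc m) * ln (1 + 1 / real m))"
    using m by (simp add: field_simps)
  also have "\<dots> = (1 + 1 / real m) ^ Suc m"
    by (subst exp_of_nat_mult) (use m in \<open>simp add: add_pos_pos\<close>)
  finally have "exp 1 * real m ^ Suc m \<le> (1 + 1 / real m) ^ Suc m * real m ^ Suc m"
    by (intro mult_right_mono) (simp_all del: power_Suc)
  also have "\<dots> = (1 + real m) ^ Suc m"
    using m by (simp add: power_mult_distrib[symmetric] field_simps)
  finally have *: "exp 1 * real m ^ Suc m \<le> real (Suc m) ^ Suc m" by simp
  have "fact (Suc m) = real (Suc m) * fact m" by simp
  also have "\<dots> \<le> real (Suc m) * (exp 1 * real m * (real m / exp 1) ^ m)"
    by (intro mult_left_mono step.IH) simp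
  also have "\<dots> = real (Suc m) * (exp 1 * real m ^ Suc m) / exp 1 ^ m"
    by (simp add: power_divide)
  also have "\<dots> \<le> real (Suc m) * real (Suc m) ^ Suc m / exp 1 ^ m"
    by (intro divide_right_mono mult_left_mono *) auto
  also have "\<dots> = exp 1 * real (Suc m) * (real (Suc m) / exp 1) ^ Suc m"
    by (simp add: power_divide)
  finally show ?case by simp
qed

lemma exp_quadratic_bound: "0 \<le> x \<Longrightarrow> exp x \<le> 1 + x + x\<^sup>2 * exp (x::real)"
proof -
  assume x: "0 \<le> x"
  obtain t where t: "\<bar>t\<bar> \<le> \<bar>x\<bar>" "exp x = (\<Sum>m<2. x ^ m / fact m) + exp t / fact 2 * x ^ 2"
    using Maclaurin_exp_le[of x 2] by blast
  have "exp t \<le> exp x" "0 < exp t" using t(1) x by auto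
  then have "exp t / 2 \<le> exp x" by linarith
  then have "exp t / 2 * x\<^sup>2 \<le> exp x * x\<^sup>2"
    by (intro mult_right_mono) auto
  then show ?thesis using t by (simp add: numeral_2_eq_2 algebra_simps)
qed

lemma power2_le_exp_powr:
  fixes x \<alpha> :: real
  assumes "0 \<le> x" "0 < \<alpha>"
  shows "x\<^sup>2 \<le> (2 * \<alpha>) powr (2 * \<alpha>) * exp (x powr (1 / \<alpha>))"
proof (cases "x = 0")
  case False
  then have x: "0 < x" using assms by simp
  let ?y = "x powr (1 / \<alpha>)"
  have "?y / (2 * \<alpha>) \<le> exp (?y / (2 * \<alpha>))"
    using exp_ge_add_one_self[of "?y / (2 * \<alpha>)"] by linarith
  then have "?y \<le> 2 * \<alpha> * exp (?y / (2 * \<alpha>))" using assms by (simp add: field_simps)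
  then have "?y powr (2 * \<alpha>) \<le> (2 * \<alpha> * exp (?y / (2 * \<alpha>))) powr (2 * \<alpha>)"
    using assms by (intro powr_mono2) auto
  also have "\<dots> = (2 * \<alpha>) powr (2 * \<alpha>) * exp ?y"
    using assms by (simp add: powr_mult exp_powr_real)
  also have "?y powr (2 * \<alpha>) = x\<^sup>2"
    using assms x by (simp add: powr_powr powr_numeral)
  finally show ?thesis .
qed simp

lemma (in prob_space) mixed_poisson_tail:
  assumes X: "mixed_poisson M X K" and [measurable]: "K \<in> borel_measurable M"
    and K: "\<And>\<omega>. \<omega> \<in> space M \<Longrightarrow> 0 \<le> K \<omega>"
  shows "prob {\<omega> \<in> space M. m \<le> X \<omega>} = expectation (\<lambda>\<omega>. poisson_tail m (K \<omega>))"
    and "integrable M (\<lambda>\<omega>. poisson_tail m (K \<omega>))"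
proof -
  have [measurable]: "X \<in> M \<rightarrow>\<^sub>M count_space UNIV" using X by (simp add: mixed_poisson_def)
  have le1: "exp (- y) * y ^ k / fact k \<le> 1" if "0 \<le> y" for y :: real and k
    using poisson_tail_bounds[OF that, of k] by linarith
  have int: "integrable M (\<lambda>\<omega>. exp (- K \<omega>) * K \<omega> ^ k / fact k)" for k
    by (rule integrable_const_bound[of _ 1])
       (use K le1 in \<open>auto intro!: AE_I2 simp: abs_mult\<close>)
  show "integrable M (\<lambda>\<omega>. poisson_tail m (K \<omega>))"
    unfolding poisson_tail_def by (intro Bochner_Integration.integrable_diff Bochner_Integration.integrable_sum int) simp
  have "prob {\<omega> \<in> space M. X \<omega> < m} = prob (\<Union>k<m. {\<omega> \<in> space M. X \<omega> = k})"
    by (rule arg_cong[where f = prob]) auto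
  also have "\<dots> = (\<Sum>k<m. prob {\<omega> \<in> space M. X \<omega> = k})"
    by (rule finite_measure_finite_Union) (auto simp: disjoint_family_on_def)
  also have "\<dots> = (\<Sum>k<m. expectation (\<lambda>\<omega>. exp (- K \<omega>) * K \<omega> ^ k / fact k))"
    using X by (simp add: mixed_poisson_def)
  finally have "prob {\<omega> \<in> space M. X \<omega> < m} = (\<Sum>k<m. expectation (\<lambda>\<omega>. exp (- K \<omega>) * K \<omega> ^ k / fact k))" .
  moreover have "prob {\<omega> \<in> space M. m \<le> X \<omega>} = 1 - prob {\<omega> \<in> space M. X \<omega> < m}"
    using prob_neg[of "\<lambda>\<omega>. X \<omega> < m"] by (simp add: not_less)
  moreover have "expectation (\<lambda>\<omega>. poisson_tail m (K \<omega>)) = 1 - (\<Sum>k<m. expectation (\<lambda>\<omega>. exp (- K \<omega>) * K \<omega> ^ k / fact k))"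
    unfolding poisson_tail_def
    by (subst Bochner_Integration.integral_diff)
       (auto simp: prob_space Bochner_Integration.integral_sum int intro!: Bochner_Integration.integrable_sum int)
  ultimately show "prob {\<omega> \<in> space M. m \<le> X \<omega>} = expectation (\<lambda>\<omega>. poisson_tail m (K \<omega>))" by simp
qed

section \<open>Exponential estimates for the averaged environment\<close>

locale resampled_environment = prob_space M for M :: "'a measure" +
  fixes L :: "nat \<Rightarrow> 'a \<Rightarrow> real" and \<Lambda> :: "'a \<Rightarrow> real" and \<alpha> :: real
  assumes \<alpha>: "1 < \<alpha>"
    and \<Lambda>_measurable [measurable]: "\<Lambda> \<in> borel_measurable M"
    and \<Lambda>_integrable: "integrable M \<Lambda>"
    and \<Lambda>_square_integrable: "integrable M (\<lambda>\<omega>. (\<Lambda> \<omega>)\<^sup>2)"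
    and \<Lambda>_light_tail: "\<And>\<theta>. 0 < \<theta> \<Longrightarrow> integrable M (\<lambda>\<omega>. exp (\<theta> * \<Lambda> \<omega> powr (1 / \<alpha>)))"
    and L_distr: "\<And>j. distr M borel (L j) = distr M borel \<Lambda>"
    and L_nonneg: "\<And>j \<omega>. \<omega> \<in> space M \<Longrightarrow> 0 \<le> L j \<omega>"
    and \<Lambda>_nonneg: "\<And>\<omega>. \<omega> \<in> space M \<Longrightarrow> 0 \<le> \<Lambda> \<omega>"
    and L_indep: "indep_vars (\<lambda>_. borel) L UNIV"
begin

lemma L_measurable [measurable]: "L j \<in> borel_measurable M"
  using L_indep by (auto simp: indep_vars_def)

lemma
  fixes f :: "real \<Rightarrow> real"
  assumes [measurable]: "f \<in> borel_measurable borel"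
  shows L_integrable_iff: "integrable M (\<lambda>\<omega>. f (L j \<omega>)) \<longleftrightarrow> integrable M (\<lambda>\<omega>. f (\<Lambda> \<omega>))"
    and L_expectation: "expectation (\<lambda>\<omega>. f (L j \<omega>)) = expectation (\<lambda>\<omega>. f (\<Lambda> \<omega>))"
proof -
  show "integrable M (\<lambda>\<omega>. f (L j \<omega>)) \<longleftrightarrow> integrable M (\<lambda>\<omega>. f (\<Lambda> \<omega>))"
    using integrable_distr_eq[of "L j" M borel f] integrable_distr_eq[of \<Lambda> M borel f]
    by (simp add: L_distr)
  show "expectation (\<lambda>\<omega>. f (L j \<omega>)) = expectation (\<lambda>\<omega>. f (\<Lambda> \<omega>))"
    using integral_distr[of "L j" M borel f] integral_distr[of \<Lambda> M borel f]
    by (simp add: L_distr)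
qed

abbreviation "m\<^sub>\<Lambda> \<equiv> expectation \<Lambda>"
abbreviation "v\<^sub>\<Lambda> \<equiv> variance \<Lambda>"

text \<open>Chebyshev: the variance of a weighted sum of independent variables is at most the largest weight times
the total weight times the common variance, hence vanishes with the slot length.\<close>

lemma weighted_sum_concentration:
  assumes w: "\<And>j. j < n \<Longrightarrow> 0 \<le> w j \<and> w j \<le> \<delta>" and \<epsilon>: "0 < \<epsilon>"
  shows "prob {\<omega> \<in> space M. \<epsilon> \<le> \<bar>(\<Sum>j<n. w j * L j \<omega>) - (\<Sum>j<n. w j) * m\<^sub>\<Lambda>\<bar>}
    \<le> \<delta> * (\<Sum>j<n. w j) * v\<^sub>\<Lambda> / \<epsilon>\<^sup>2"
proof -
  let ?c = "\<lambda>j \<omega>. L j \<omega> - m\<^sub>\<Lambda>"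
  have iL: "integrable M (L j)" for j
    using L_integrable_iff[of "\<lambda>x. x" j] \<Lambda>_integrable by simp
  have eL: "expectation (L j) = m\<^sub>\<Lambda>" for j
    using L_expectation[of "\<lambda>x. x" j] by simp
  have ic: "integrable M (?c j)" for j using iL by simp
  have sq: "integrable M (\<lambda>\<omega>. (?c j \<omega>)\<^sup>2)" for j
  proof -
    have "integrable M (\<lambda>\<omega>. (\<Lambda> \<omega> - m\<^sub>\<Lambda>)\<^sup>2)"
      using \<Lambda>_integrable \<Lambda>_square_integrable by (simp add: power2_diff)
    then show ?thesis using L_integrable_iff[of "\<lambda>x. (x - m\<^sub>\<Lambda>)\<^sup>2" j] by simp
  qed
  have esq: "expectation (\<lambda>\<omega>. (?c j \<omega>)\<^sup>2) = v\<^sub>\<Lambda>" for j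
    using L_expectation[of "\<lambda>x. (x - m\<^sub>\<Lambda>)\<^sup>2" j] by simp
  have indep: "indep_var borel (?c i) borel (?c j)" if "i \<noteq> j" for i j
  proof -
    have "indep_var borel (L i) borel (L j)"
      using indep_var_compose[OF indep_var_restrict[OF L_indep, of "{i}" "{j}"],
          of "\<lambda>f. f i" borel "\<lambda>f. f j" borel] that
      by (simp add: o_def)
    from indep_var_compose[OF this, of "\<lambda>x. x - m\<^sub>\<Lambda>" borel "\<lambda>x. x - m\<^sub>\<Lambda>" borel]
    show ?thesis by (simp add: o_def)
  qed
  \<comment> \<open>distinct centred variables are orthogonal\<close>
  have prod: "integrable M (\<lambda>\<omega>. ?c i \<omega> * ?c j \<omega>) \<and>
      expectation (\<lambda>\<omega>. ?c i \<omega> * ?c j \<omega>) = (if i = j then v\<^sub>\<Lambda> else 0)" for i j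
  proof (cases "i = j")
    case True then show ?thesis using sq[of j] esq[of j] by (simp add: power2_eq_square)
  next
    case False
    have "expectation (?c i) = 0" using iL eL by (simp add: prob_space)
    then show ?thesis
      using False indep_var_integrable[OF indep[OF False] ic ic]
        indep_var_lebesgue_integral[OF indep[OF False] ic ic] by simp
  qed
  let ?Y = "\<lambda>\<omega>. \<Sum>j<n. w j * ?c j \<omega>"
  have Ysq: "(?Y \<omega>)\<^sup>2 = (\<Sum>i<n. \<Sum>j<n. w i * w j * (?c i \<omega> * ?c j \<omega>))" for \<omega>
    by (simp add: power2_eq_square sum_product mult_ac)
  have Yint: "integrable M (\<lambda>\<omega>. (?Y \<omega>)\<^sup>2)"
    unfolding Ysq by (intro Bochner_Integration.integrable_sum integrable_mult_right) (use prod in blast)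
  have EY: "expectation ?Y = 0"
    using iL eL by (subst Bochner_Integration.integral_sum) (auto simp: prob_space)
  have "expectation (\<lambda>\<omega>. (?Y \<omega>)\<^sup>2) = (\<Sum>i<n. \<Sum>j<n. w i * w j * (if i = j then v\<^sub>\<Lambda> else 0))"
    unfolding Ysq using prod
    by (subst Bochner_Integration.integral_sum) (auto intro!: Bochner_Integration.integrable_sum sum.cong)
  also have "\<dots> = (\<Sum>i<n. w i * w i * v\<^sub>\<Lambda>)"
    by (intro sum.cong refl) (simp add: if_distrib cong: if_cong)
  also have "\<dots> \<le> (\<Sum>i<n. \<delta> * w i * v\<^sub>\<Lambda>)"
    using w variance_positive[of \<Lambda>] by (intro sum_mono mult_right_mono) auto
  also have "\<dots> = \<delta> * (\<Sum>i<n. w i) * v\<^sub>\<Lambda>" by (simp add: sum_distrib_left sum_distrib_right mult_ac)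
  finally have V: "expectation (\<lambda>\<omega>. (?Y \<omega>)\<^sup>2) \<le> \<delta> * (\<Sum>i<n. w i) * v\<^sub>\<Lambda>" .
  have "prob {\<omega> \<in> space M. \<epsilon> \<le> \<bar>?Y \<omega> - expectation ?Y\<bar>} \<le> variance ?Y / \<epsilon>\<^sup>2"
    by (rule Chebyshev_inequality) (use Yint \<epsilon> in auto)
  also have "\<dots> \<le> \<delta> * (\<Sum>i<n. w i) * v\<^sub>\<Lambda> / \<epsilon>\<^sup>2"
    using V by (intro divide_right_mono) (auto simp: EY)
  finally have bound: "prob {\<omega> \<in> space M. \<epsilon> \<le> \<bar>?Y \<omega>\<bar>} \<le> \<delta> * (\<Sum>i<n. w i) * v\<^sub>\<Lambda> / \<epsilon>\<^sup>2"
    unfolding EY diff_0_right .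
  have "?Y \<omega> = (\<Sum>j<n. w j * L j \<omega>) - (\<Sum>j<n. w j) * m\<^sub>\<Lambda>" for \<omega>
    by (simp add: sum_subtractf right_diff_distrib sum_distrib_right)
  with bound show ?thesis by simp
qed

text \<open>With \<open>b = N\<close>: by Markov's inequality for \<open>exp (\<theta> \<Lambda>^{1/\<alpha>})\<close>, a single value above \<open>N^\<alpha>\<close> costs \<open>e^{-\<theta>N}\<close> for
every \<open>\<theta>\<close>. As there are only of order \<open>N^\<alpha>\<close> slots, such values are negligible on the exponential scale.\<close>

lemma exceedance_bound:
  assumes "0 < \<theta>" "0 \<le> b"
  shows "prob {\<omega> \<in> space M. \<exists>j<n. b powr \<alpha> < L j \<omega>}
    \<le> real n * expectation (\<lambda>\<omega>. exp (\<theta> * \<Lambda> \<omega> powr (1 / \<alpha>))) * exp (- \<theta> * b)"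
proof -
  let ?C = "expectation (\<lambda>\<omega>. exp (\<theta> * \<Lambda> \<omega> powr (1 / \<alpha>)))"
  have single: "prob {\<omega> \<in> space M. b powr \<alpha> < L j \<omega>} \<le> ?C * exp (- \<theta> * b)" for j
  proof -
    let ?f = "\<lambda>\<omega>. exp (\<theta> * L j \<omega> powr (1 / \<alpha>)) * exp (- \<theta> * b)"
    have i: "integrable M ?f"
      using L_integrable_iff[of "\<lambda>x. exp (\<theta> * x powr (1 / \<alpha>))" j] \<Lambda>_light_tail[OF assms(1)] by simp
    have "prob {\<omega> \<in> space M. b powr \<alpha> < L j \<omega>} = expectation (indicator {\<omega> \<in> space M. b powr \<alpha> < L j \<omega>})"
      by simp
    also have "\<dots> \<le> expectation ?f"
    proof (rule integral_mono[OF _ i])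
      fix \<omega> assume "\<omega> \<in> space M"
      show "indicator {\<omega> \<in> space M. b powr \<alpha> < L j \<omega>} \<omega> \<le> ?f \<omega>"
      proof (cases "b powr \<alpha> < L j \<omega>")
        case True
        then have "(b powr \<alpha>) powr (1 / \<alpha>) \<le> L j \<omega> powr (1 / \<alpha>)"
          using \<alpha> by (intro powr_mono2) auto
        then have "b \<le> L j \<omega> powr (1 / \<alpha>)" using assms \<alpha> by (simp add: powr_powr)
        then have "0 \<le> \<theta> * L j \<omega> powr (1 / \<alpha>) + - \<theta> * b" using assms by simp
        then have "1 \<le> ?f \<omega>" unfolding exp_add[symmetric] by simp
        then show ?thesis by (simp add: indicator_def)
      qed simp
    qed (auto simp: integrable_indicator_iff emeasure_eq_measure)
    also have "\<dots> = ?C * exp (- \<theta> * b)"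
      using L_expectation[of "\<lambda>x. exp (\<theta> * x powr (1 / \<alpha>))" j] by simp
    finally show ?thesis .
  qed
  have "{\<omega> \<in> space M. \<exists>j<n. b powr \<alpha> < L j \<omega>} = (\<Union>j<n. {\<omega> \<in> space M. b powr \<alpha> < L j \<omega>})" by auto
  then have "prob {\<omega> \<in> space M. \<exists>j<n. b powr \<alpha> < L j \<omega>} \<le> (\<Sum>j<n. prob {\<omega> \<in> space M. b powr \<alpha> < L j \<omega>})"
    by (simp only:, intro finite_measure_subadditive_finite) auto
  also have "\<dots> \<le> (\<Sum>j<n. ?C * exp (- \<theta> * b))" by (intro sum_mono single)
  finally show ?thesis by simp
qed

lemma square_exp_root_integrable:
  assumes "0 \<le> s" shows "integrable M (\<lambda>\<omega>. (\<Lambda> \<omega>)\<^sup>2 * exp (s * \<Lambda> \<omega> powr (1 / \<alpha>)))"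
proof (rule Bochner_Integration.integrable_bound)
  show "integrable M (\<lambda>\<omega>. (2 * \<alpha>) powr (2 * \<alpha>) * exp ((s + 1) * \<Lambda> \<omega> powr (1 / \<alpha>)))"
    using assms by (intro integrable_mult_right \<Lambda>_light_tail) simp
  show "AE \<omega> in M. norm ((\<Lambda> \<omega>)\<^sup>2 * exp (s * \<Lambda> \<omega> powr (1 / \<alpha>)))
      \<le> norm ((2 * \<alpha>) powr (2 * \<alpha>) * exp ((s + 1) * \<Lambda> \<omega> powr (1 / \<alpha>)))"
  proof (rule AE_I2)
    fix \<omega> assume "\<omega> \<in> space M"
    have "(\<Lambda> \<omega>)\<^sup>2 * exp (s * \<Lambda> \<omega> powr (1 / \<alpha>))
        \<le> ((2 * \<alpha>) powr (2 * \<alpha>) * exp (\<Lambda> \<omega> powr (1 / \<alpha>))) * exp (s * \<Lambda> \<omega> powr (1 / \<alpha>))"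
      using \<alpha> \<Lambda>_nonneg[OF \<open>\<omega> \<in> space M\<close>] by (intro mult_right_mono power2_le_exp_powr) auto
    also have "\<dots> = (2 * \<alpha>) powr (2 * \<alpha>) * exp ((s + 1) * \<Lambda> \<omega> powr (1 / \<alpha>))"
      by (simp add: distrib_right exp_add mult_ac)
    finally show "norm ((\<Lambda> \<omega>)\<^sup>2 * exp (s * \<Lambda> \<omega> powr (1 / \<alpha>)))
      \<le> norm ((2 * \<alpha>) powr (2 * \<alpha>) * exp ((s + 1) * \<Lambda> \<omega> powr (1 / \<alpha>)))" by simp
  qed
qed measurable

text \<open>Truncation at \<open>b^\<alpha>\<close> is exactly what the light-tail condition can absorb: for \<open>Y = min \<Lambda> (b^\<alpha>)\<close>,
\<open>b^{1-\<alpha>} Y \<le> Y^{1/\<alpha>}\<close>, because \<open>Y^{1-1/\<alpha>} \<le> b^{\<alpha>-1}\<close>. So although \<open>\<Lambda>\<close> itself may have no exponential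
moment, the exponent \<open>\<sigma> Y\<close> with \<open>\<sigma> \<le> s b^{1-\<alpha>}\<close> stays below \<open>s \<Lambda>^{1/\<alpha>}\<close>, and a second-order expansion
of the exponential is integrable.\<close>

lemma truncated_mgf_single:
  assumes \<sigma>: "0 \<le> \<sigma>" "\<sigma> \<le> s * b powr (1 - \<alpha>)" and b: "0 < b" and s: "0 \<le> s"
  shows "expectation (\<lambda>\<omega>. exp (\<sigma> * min (L j \<omega>) (b powr \<alpha>)))
    \<le> exp (\<sigma> * m\<^sub>\<Lambda> + \<sigma>\<^sup>2 * expectation (\<lambda>\<omega>. (\<Lambda> \<omega>)\<^sup>2 * exp (s * \<Lambda> \<omega> powr (1 / \<alpha>))))"
    and "integrable M (\<lambda>\<omega>. exp (\<sigma> * min (L j \<omega>) (b powr \<alpha>)))"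
proof -
  let ?Y = "\<lambda>\<omega>. min (\<Lambda> \<omega>) (b powr \<alpha>)" and ?E = "\<lambda>\<omega>. (\<Lambda> \<omega>)\<^sup>2 * exp (s * \<Lambda> \<omega> powr (1 / \<alpha>))"
  have int: "integrable M (\<lambda>\<omega>. exp (\<sigma> * ?Y \<omega>))"
    by (rule integrable_const_bound[of _ "exp (\<sigma> * b powr \<alpha>)"])
       (use \<sigma> in \<open>auto intro!: AE_I2 mult_left_mono\<close>)
  then show "integrable M (\<lambda>\<omega>. exp (\<sigma> * min (L j \<omega>) (b powr \<alpha>)))"
    using L_integrable_iff[of "\<lambda>x. exp (\<sigma> * min x (b powr \<alpha>))" j] by simp
  have point: "exp (\<sigma> * ?Y \<omega>) \<le> 1 + \<sigma> * \<Lambda> \<omega> + \<sigma>\<^sup>2 * ?E \<omega>" if \<omega>: "\<omega> \<in> space M" for \<omega>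
  proof -
    have Y: "0 \<le> ?Y \<omega>" "?Y \<omega> \<le> \<Lambda> \<omega>" "?Y \<omega> \<le> b powr \<alpha>" using \<Lambda>_nonneg[OF \<omega>] by auto
    have "b powr (1 - \<alpha>) * ?Y \<omega> \<le> \<Lambda> \<omega> powr (1 / \<alpha>)"
    proof (cases "?Y \<omega> = 0")
      case False
      then have y: "0 < ?Y \<omega>" using Y by linarith
      have "?Y \<omega> powr (1 - 1 / \<alpha>) \<le> (b powr \<alpha>) powr (1 - 1 / \<alpha>)"
        using Y \<alpha> by (intro powr_mono2) auto
      also have "\<dots> = b powr (\<alpha> - 1)" using \<alpha> by (simp add: powr_powr algebra_simps)
      finally have "b powr (1 - \<alpha>) * ?Y \<omega> powr (1 - 1 / \<alpha>) \<le> b powr (1 - \<alpha>) * b powr (\<alpha> - 1)"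
        by (intro mult_left_mono) auto
      also have "\<dots> = 1" using b by (simp add: powr_add[symmetric])
      finally have *: "b powr (1 - \<alpha>) * ?Y \<omega> powr (1 - 1 / \<alpha>) * ?Y \<omega> powr (1 / \<alpha>) \<le> 1 * ?Y \<omega> powr (1 / \<alpha>)"
        by (intro mult_right_mono) auto
      have "?Y \<omega> powr (1 - 1 / \<alpha>) * ?Y \<omega> powr (1 / \<alpha>) = ?Y \<omega>"
        using y by (simp add: powr_add[symmetric])
      with * have "b powr (1 - \<alpha>) * ?Y \<omega> \<le> ?Y \<omega> powr (1 / \<alpha>)" by (simp add: mult.assoc)
      also have "\<dots> \<le> \<Lambda> \<omega> powr (1 / \<alpha>)" using Y \<alpha> by (intro powr_mono2) auto
      finally show ?thesis .
    qed simp
    then have "s * (b powr (1 - \<alpha>) * ?Y \<omega>) \<le> s * \<Lambda> \<omega> powr (1 / \<alpha>)" using s by (rule mult_left_mono)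
    moreover have "\<sigma> * ?Y \<omega> \<le> (s * b powr (1 - \<alpha>)) * ?Y \<omega>" using \<sigma> Y by (intro mult_right_mono) auto
    ultimately have e: "exp (\<sigma> * ?Y \<omega>) \<le> exp (s * \<Lambda> \<omega> powr (1 / \<alpha>))" by (simp add: mult.assoc)
    have "exp (\<sigma> * ?Y \<omega>) \<le> 1 + \<sigma> * ?Y \<omega> + (\<sigma> * ?Y \<omega>)\<^sup>2 * exp (\<sigma> * ?Y \<omega>)"
      using \<sigma> Y by (intro exp_quadratic_bound) auto
    also have "\<dots> \<le> 1 + \<sigma> * \<Lambda> \<omega> + (\<sigma> * \<Lambda> \<omega>)\<^sup>2 * exp (s * \<Lambda> \<omega> powr (1 / \<alpha>))"
      using \<sigma> Y e by (intro add_mono mult_mono mult_left_mono power_mono order_refl) auto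
    finally show ?thesis by (simp add: power_mult_distrib mult.assoc)
  qed
  have E: "integrable M ?E" by (rule square_exp_root_integrable[OF s])
  have "expectation (\<lambda>\<omega>. exp (\<sigma> * min (L j \<omega>) (b powr \<alpha>))) = expectation (\<lambda>\<omega>. exp (\<sigma> * ?Y \<omega>))"
    using L_expectation[of "\<lambda>x. exp (\<sigma> * min x (b powr \<alpha>))" j] by simp
  also have "\<dots> \<le> expectation (\<lambda>\<omega>. 1 + \<sigma> * \<Lambda> \<omega> + \<sigma>\<^sup>2 * ?E \<omega>)"
    using E \<Lambda>_integrable by (intro integral_mono int point) auto
  also have "\<dots> = 1 + (\<sigma> * m\<^sub>\<Lambda> + \<sigma>\<^sup>2 * expectation ?E)"
    using E \<Lambda>_integrable by (simp add: prob_space)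
  also have "\<dots> \<le> exp (\<sigma> * m\<^sub>\<Lambda> + \<sigma>\<^sup>2 * expectation ?E)" by (rule exp_ge_add_one_self)
  finally show "expectation (\<lambda>\<omega>. exp (\<sigma> * min (L j \<omega>) (b powr \<alpha>)))
    \<le> exp (\<sigma> * m\<^sub>\<Lambda> + \<sigma>\<^sup>2 * expectation ?E)" .
qed

text \<open>The first-order terms add up to the mean; the second-order terms add up to order \<open>b^{2-\<alpha>}\<close>, which is
\<open>o(b)\<close> since \<open>\<alpha> > 1\<close>. Hence the environment does not fluctuate on the exponential scale.\<close>

lemma truncated_mgf:
  assumes w: "\<And>j. j < n \<Longrightarrow> 0 \<le> w j \<and> w j \<le> \<delta> * b powr (- \<alpha>)" and b: "0 < b" and s: "0 \<le> s"
    and \<delta>: "0 \<le> \<delta>"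
  defines "E \<equiv> expectation (\<lambda>\<omega>. (\<Lambda> \<omega>)\<^sup>2 * exp (s * \<delta> * \<Lambda> \<omega> powr (1 / \<alpha>)))"
  shows "expectation (\<lambda>\<omega>. exp (s * (b * (\<Sum>j<n. w j * min (L j \<omega>) (b powr \<alpha>)))))
    \<le> exp (s * b * (\<Sum>j<n. w j) * m\<^sub>\<Lambda> + s\<^sup>2 * \<delta> * b powr (2 - \<alpha>) * (\<Sum>j<n. w j) * E)"
    and "integrable M (\<lambda>\<omega>. exp (s * (b * (\<Sum>j<n. w j * min (L j \<omega>) (b powr \<alpha>)))))"
proof -
  define \<sigma> where "\<sigma> j = s * b * w j" for j
  have E0: "0 \<le> E" unfolding E_def by (rule integral_nonneg_AE) auto
  have \<sigma>: "0 \<le> \<sigma> j" "\<sigma> j \<le> s * \<delta> * b powr (1 - \<alpha>)" if "j < n" for j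
  proof -
    show "0 \<le> \<sigma> j" using w[OF that] b s by (simp add: \<sigma>_def)
    have "\<sigma> j \<le> s * b * (\<delta> * b powr (- \<alpha>))"
      unfolding \<sigma>_def using w[OF that] b s by (intro mult_left_mono) auto
    also have "\<dots> = s * \<delta> * b powr (1 - \<alpha>)"
      using b by (simp add: powr_diff powr_minus divide_inverse mult_ac)
    finally show "\<sigma> j \<le> s * \<delta> * b powr (1 - \<alpha>)" .
  qed
  let ?X = "\<lambda>j \<omega>. exp (\<sigma> j * min (L j \<omega>) (b powr \<alpha>))"
  have prod: "exp (s * (b * (\<Sum>j<n. w j * min (L j \<omega>) (b powr \<alpha>)))) = (\<Prod>j<n. ?X j \<omega>)" for \<omega>
    by (simp add: exp_sum[symmetric] sum_distrib_left \<sigma>_def mult_ac)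
  have ind: "indep_vars (\<lambda>_. borel) ?X {..<n}"
    by (rule indep_vars_compose2[OF indep_vars_subset[OF L_indep]]) auto
  have s\<delta>: "0 \<le> s * \<delta>" using s \<delta> by simp
  note single = truncated_mgf_single[OF \<sigma> b s\<delta>, folded E_def]
  have int: "integrable M (?X j)" if "j \<in> {..<n}" for j using single(2) that by auto
  show "integrable M (\<lambda>\<omega>. exp (s * (b * (\<Sum>j<n. w j * min (L j \<omega>) (b powr \<alpha>)))))"
    unfolding prod by (rule indep_vars_integrable[OF _ ind int]) auto
  have "expectation (\<lambda>\<omega>. exp (s * (b * (\<Sum>j<n. w j * min (L j \<omega>) (b powr \<alpha>)))))
      = (\<Prod>j<n. expectation (?X j))"
    unfolding prod by (rule indep_vars_lebesgue_integral[OF _ ind int]) auto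
  also have "\<dots> \<le> (\<Prod>j<n. exp (\<sigma> j * m\<^sub>\<Lambda> + (\<sigma> j)\<^sup>2 * E))"
    using single(1) by (intro prod_mono) (auto intro!: integral_nonneg_AE)
  also have "\<dots> = exp (\<Sum>j<n. \<sigma> j * m\<^sub>\<Lambda> + (\<sigma> j)\<^sup>2 * E)" by (simp add: exp_sum)
  also have "\<dots> \<le> exp (s * b * (\<Sum>j<n. w j) * m\<^sub>\<Lambda> + s\<^sup>2 * \<delta> * b powr (2 - \<alpha>) * (\<Sum>j<n. w j) * E)"
  proof -
    have "(\<Sum>j<n. (\<sigma> j)\<^sup>2 * E) \<le> (\<Sum>j<n. (s * \<delta> * b powr (1 - \<alpha>) * \<sigma> j) * E)"
      using \<sigma> E0 by (intro sum_mono mult_right_mono) (auto simp: power2_eq_square intro!: mult_right_mono)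
    also have "\<dots> = s\<^sup>2 * \<delta> * b powr (2 - \<alpha>) * (\<Sum>j<n. w j) * E"
    proof -
      have "b powr (2 - \<alpha>) = b powr (1 - \<alpha>) * b"
        using b powr_add[of b "1 - \<alpha>" 1] by simp
      then show ?thesis by (simp add: \<sigma>_def sum_distrib_left sum_distrib_right power2_eq_square mult_ac)
    qed
    finally show ?thesis by (simp add: sum.distrib \<sigma>_def sum_distrib_left sum_distrib_right mult_ac)
  qed
  finally show "expectation (\<lambda>\<omega>. exp (s * (b * (\<Sum>j<n. w j * min (L j \<omega>) (b powr \<alpha>)))))
    \<le> exp (s * b * (\<Sum>j<n. w j) * m\<^sub>\<Lambda> + s\<^sup>2 * \<delta> * b powr (2 - \<alpha>) * (\<Sum>j<n. w j) * E)" .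
qed

section \<open>Large deviations of the mixed Poisson variable\<close>

text \<open>Off the event that some rate exceeds \<open>b^\<alpha>\<close> the truncation changes nothing, and the conditional Chernoff
bound can be averaged over the truncated environment.\<close>

lemma mixed_poisson_upper_bound:
  assumes w: "\<And>j. j < n \<Longrightarrow> 0 \<le> w j \<and> w j \<le> \<delta> * b powr (- \<alpha>)"
    and b: "0 < b" and \<delta>: "0 \<le> \<delta>" and \<eta>: "0 < \<eta>" and \<theta>: "0 \<le> \<theta>"
    and X: "mixed_poisson M X (\<lambda>\<omega>. b * (\<Sum>j<n. w j * L j \<omega>))"
  defines "s \<equiv> exp \<theta> - 1"
  shows "prob {\<omega> \<in> space M. m \<le> X \<omega>}
    \<le> real n * expectation (\<lambda>\<omega>. exp (\<eta> * \<Lambda> \<omega> powr (1 / \<alpha>))) * exp (- \<eta> * b)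
      + exp (- \<theta> * real m + s * b * (\<Sum>j<n. w j) * m\<^sub>\<Lambda> + s\<^sup>2 * \<delta> * b powr (2 - \<alpha>) * (\<Sum>j<n. w j)
          * expectation (\<lambda>\<omega>. (\<Lambda> \<omega>)\<^sup>2 * exp (s * \<delta> * \<Lambda> \<omega> powr (1 / \<alpha>))))"
proof -
  let ?K = "\<lambda>\<omega>. b * (\<Sum>j<n. w j * L j \<omega>)"
  let ?K' = "\<lambda>\<omega>. b * (\<Sum>j<n. w j * min (L j \<omega>) (b powr \<alpha>))"
  let ?B = "{\<omega> \<in> space M. \<exists>j<n. b powr \<alpha> < L j \<omega>}"
  have s: "0 \<le> s" using \<theta> by (simp add: s_def)
  have K0: "0 \<le> ?K \<omega>" if "\<omega> \<in> space M" for \<omega>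
    using b w L_nonneg[OF that] by (intro mult_nonneg_nonneg sum_nonneg) auto
  have [measurable]: "?K \<in> borel_measurable M" by measurable
  note tail = mixed_poisson_tail[OF X this K0]
  have iB: "integrable M (indicator ?B :: 'a \<Rightarrow> real)"
    by (auto simp: integrable_indicator_iff emeasure_eq_measure)
  have mgf: "integrable M (\<lambda>\<omega>. exp (s * ?K' \<omega>))"
    by (rule truncated_mgf(2)[OF w b s \<delta>])
  have "prob {\<omega> \<in> space M. m \<le> X \<omega>} = expectation (\<lambda>\<omega>. poisson_tail m (?K \<omega>))"
    by (rule tail(1))
  also have "\<dots> \<le> expectation (\<lambda>\<omega>. indicator ?B \<omega> + exp (- \<theta> * real m) * exp (s * ?K' \<omega>))"
  proof (rule integral_mono[OF tail(2)])
    show "integrable M (\<lambda>\<omega>. indicator ?B \<omega> + exp (- \<theta> * real m) * exp (s * ?K' \<omega>))"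
      by (intro Bochner_Integration.integrable_add iB integrable_mult_right mgf)
    fix \<omega> assume \<omega>: "\<omega> \<in> space M"
    show "poisson_tail m (?K \<omega>) \<le> indicator ?B \<omega> + exp (- \<theta> * real m) * exp (s * ?K' \<omega>)"
    proof (cases "\<omega> \<in> ?B")
      case True
      then show ?thesis using poisson_tail_bounds(2)[OF K0[OF \<omega>], of m] by (simp add: add_increasing2)
    next
      case False
      have "min (L j \<omega>) (b powr \<alpha>) = L j \<omega>" if "j < n" for j
        using False \<omega> that by (auto simp: min_def)
      then have K': "?K' \<omega> = ?K \<omega>" by simp
      have "poisson_tail m (?K \<omega>) \<le> exp (- \<theta> * real m) * exp (s * ?K \<omega>)"
        using poisson_tail_chernoff[OF K0[OF \<omega>] \<theta>, of m] unfolding s_def exp_add .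
      then show ?thesis
        unfolding K' using False by simp
    qed
  qed
  also have "\<dots> = prob ?B + exp (- \<theta> * real m) * expectation (\<lambda>\<omega>. exp (s * ?K' \<omega>))"
    using iB mgf by (subst Bochner_Integration.integral_add) auto
  also have "\<dots> \<le> real n * expectation (\<lambda>\<omega>. exp (\<eta> * \<Lambda> \<omega> powr (1 / \<alpha>))) * exp (- \<eta> * b)
      + exp (- \<theta> * real m) * exp (s * b * (\<Sum>j<n. w j) * m\<^sub>\<Lambda> + s\<^sup>2 * \<delta> * b powr (2 - \<alpha>) * (\<Sum>j<n. w j)
          * expectation (\<lambda>\<omega>. (\<Lambda> \<omega>)\<^sup>2 * exp (s * \<delta> * \<Lambda> \<omega> powr (1 / \<alpha>))))"
    using b by (intro add_mono exceedance_bound[OF \<eta>] mult_left_mono truncated_mgf(1)[OF w b s \<delta>]) auto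
  finally show ?thesis by (simp only: exp_add[symmetric] add.assoc)
qed

text \<open>With probability at least one half the averaged environment is within \<open>\<epsilon>\<close> of its mean, and then a single
Poisson weight at \<open>m\<close> already has the right exponential order.\<close>

lemma mixed_poisson_lower_bound:
  assumes w: "\<And>j. j < n \<Longrightarrow> 0 \<le> w j \<and> w j \<le> \<delta>" and b: "0 < b"
    and X: "mixed_poisson M X (\<lambda>\<omega>. b * (\<Sum>j<n. w j * L j \<omega>))"
    and \<rho>: "(\<Sum>j<n. w j) * m\<^sub>\<Lambda> = \<rho>" and \<epsilon>: "0 < \<epsilon>" "\<epsilon> < \<rho>"
    and small: "\<delta> * (\<Sum>j<n. w j) * v\<^sub>\<Lambda> / \<epsilon>\<^sup>2 \<le> 1 / 2"
  shows "1 / 2 * (exp (- (b * (\<rho> + \<epsilon>))) * (b * (\<rho> - \<epsilon>)) ^ m / fact m) \<le> prob {\<omega> \<in> space M. m \<le> X \<omega>}"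
proof -
  let ?S = "\<lambda>\<omega>. \<Sum>j<n. w j * L j \<omega>"
  let ?G = "{\<omega> \<in> space M. \<not> \<epsilon> \<le> \<bar>?S \<omega> - \<rho>\<bar>}"
  let ?l = "exp (- (b * (\<rho> + \<epsilon>))) * (b * (\<rho> - \<epsilon>)) ^ m / fact m"
  have K0: "0 \<le> b * ?S \<omega>" if "\<omega> \<in> space M" for \<omega>
    using b w L_nonneg[OF that] by (intro mult_nonneg_nonneg sum_nonneg) auto
  have "(\<lambda>\<omega>. b * ?S \<omega>) \<in> borel_measurable M" by measurable
  note tail = mixed_poisson_tail[OF X this K0]
  have [measurable]: "?G \<in> sets M" by measurable
  have "prob {\<omega> \<in> space M. \<epsilon> \<le> \<bar>?S \<omega> - \<rho>\<bar>} \<le> 1 / 2"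
    using weighted_sum_concentration[of n w \<delta> \<epsilon>, OF w \<epsilon>(1)] small unfolding \<rho> by linarith
  then have G: "1 / 2 \<le> prob ?G"
    using prob_neg[of "\<lambda>\<omega>. \<epsilon> \<le> \<bar>?S \<omega> - \<rho>\<bar>"] by simp
  have l0: "0 \<le> ?l" using b \<epsilon> by simp
  have "1 / 2 * ?l \<le> prob ?G * ?l" using G l0 by (intro mult_right_mono) auto
  also have "\<dots> = expectation (\<lambda>\<omega>. indicator ?G \<omega> * ?l)" by simp
  also have "\<dots> \<le> expectation (\<lambda>\<omega>. poisson_tail m (b * ?S \<omega>))"
  proof (rule integral_mono[OF _ tail(2)])
    show "integrable M (\<lambda>\<omega>. indicator ?G \<omega> * ?l)"
      by (intro integrable_mult_left) (auto simp: integrable_indicator_iff emeasure_eq_measure)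
    fix \<omega> assume \<omega>: "\<omega> \<in> space M"
    show "indicator ?G \<omega> * ?l \<le> poisson_tail m (b * ?S \<omega>)"
    proof (cases "\<omega> \<in> ?G")
      case True
      then have S: "\<rho> - \<epsilon> \<le> ?S \<omega>" "?S \<omega> \<le> \<rho> + \<epsilon>" by auto
      have "?l \<le> exp (- (b * ?S \<omega>)) * (b * ?S \<omega>) ^ m / fact m"
        using S b \<epsilon> by (intro divide_right_mono mult_mono power_mono) auto
      also have "\<dots> \<le> poisson_tail m (b * ?S \<omega>)"
        by (rule poisson_tail_bounds(3)[OF K0[OF \<omega>]])
      finally show ?thesis using True by simp
    next
      case False
      then show ?thesis using poisson_tail_bounds(1)[OF K0[OF \<omega>]] by simp
    qed
  qed
  also have "\<dots> = prob {\<omega> \<in> space M. m \<le> X \<omega>}" by (rule tail(1)[symmetric])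
  finally show ?thesis .
qed

text \<open>The limit is minus the Poisson rate function for the deterministic parameter \<open>\<rho>\<close>. The tilt \<open>\<theta> = ln (a/\<rho>)\<close>
optimises the Chernoff bound, and the lower bound is taken to the limit in \<open>N\<close> first and in \<open>\<epsilon>\<close> second. The
lower bound also yields that the probabilities are eventually positive, without which the logarithm,
being zero at zero, would spoil the upper bound.\<close>

theorem mixed_poisson_ldp:
  fixes w :: "nat \<Rightarrow> nat \<Rightarrow> real" and X :: "nat \<Rightarrow> 'a \<Rightarrow> nat"
  assumes \<delta>: "0 < \<delta>" and c: "0 < c" and mpos: "0 < m\<^sub>\<Lambda>"
    and w: "\<And>N j. 1 \<le> N \<Longrightarrow> j < n N \<Longrightarrow> 0 \<le> w N j \<and> w N j \<le> \<delta> * real N powr (- \<alpha>)"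
    and w_sum: "\<And>N. 1 \<le> N \<Longrightarrow> (\<Sum>j<n N. w N j) = c"
    and n: "\<And>N. 1 \<le> N \<Longrightarrow> real (n N) \<le> C * real N powr \<alpha>"
    and X: "\<And>N. 1 \<le> N \<Longrightarrow> mixed_poisson M (X N) (\<lambda>\<omega>. real N * (\<Sum>j<n N. w N j * L j \<omega>))"
    and \<rho>: "\<rho> = c * m\<^sub>\<Lambda>" and a: "\<rho> < a"
  shows "(\<lambda>N. 1 / real N * ln (prob {\<omega> \<in> space M. a \<le> real (X N \<omega>) / real N}))
    \<longlonglongrightarrow> a * ln (\<rho> / a) - \<rho> + a"
proof -
  define p where "p N = prob {\<omega> \<in> space M. a \<le> real (X N \<omega>) / real N}" for N
  define m where "m N = nat \<lceil>a * real N\<rceil>" for N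
  define \<theta> where "\<theta> = ln (a / \<rho>)"
  define s where "s = exp \<theta> - 1"
  define I where "I = \<theta> * a - s * \<rho>"
  have \<rho>0: "0 < \<rho>" using c mpos \<rho> by simp
  then have a0: "0 < a" using a by simp
  have \<theta>: "0 \<le> \<theta>" using \<rho>0 a by (simp add: \<theta>_def)
  have I: "- I = a * ln (\<rho> / a) - \<rho> + a"
  proof -
    have "exp \<theta> * \<rho> = a" using \<rho>0 a0 by (simp add: \<theta>_def)
    moreover have "\<theta> = - ln (\<rho> / a)" using \<rho>0 a0 by (simp add: \<theta>_def ln_div)
    ultimately show ?thesis by (simp add: I_def s_def algebra_simps)
  qed
  have p_eq: "p N = prob {\<omega> \<in> space M. m N \<le> X N \<omega>}" if "1 \<le> N" for N
  proof -
    have "a \<le> real k / real N \<longleftrightarrow> m N \<le> k" for k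
      using that by (simp add: m_def field_simps ceiling_le_iff nat_le_iff)
    then show ?thesis by (simp add: p_def)
  qed
  have m_ge: "a * real N \<le> real (m N)" and m_le: "real (m N) \<le> a * real N + 1" for N
  proof -
    have "0 \<le> a * real N" using a0 by simp
    then show "a * real N \<le> real (m N)" "real (m N) \<le> a * real N + 1"
      by (auto simp: m_def real_nat_ceiling_ge of_int_ceiling_le_add_one)
  qed
  have lower: "\<forall>\<^sub>F N in sequentially. 0 < p N \<and> y < 1 / real N * ln (p N)" if y: "y < - I" for y
  proof -
    let ?f = "\<lambda>\<epsilon>. - (\<rho> + \<epsilon>) + a * (ln ((\<rho> - \<epsilon>) / a) + 1)"
    have "(?f \<longlongrightarrow> ?f 0) (at_right 0)"
      using \<rho>0 a0 by (intro tendsto_intros) auto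
    moreover have "?f 0 = - I" using \<rho>0 a0 by (simp add: I algebra_simps)
    ultimately have "\<forall>\<^sub>F \<epsilon> in at_right 0. y < ?f \<epsilon>" using y by (intro order_tendstoD) auto
    moreover have "\<forall>\<^sub>F \<epsilon> in at_right 0. 0 < \<epsilon> \<and> \<epsilon> < \<rho>"
      using \<rho>0 by (auto simp: eventually_at_right_field intro!: exI[of _ \<rho>])
    ultimately have "\<exists>\<epsilon>. y < ?f \<epsilon> \<and> 0 < \<epsilon> \<and> \<epsilon> < \<rho>"
      by (intro eventually_happens'[OF trivial_limit_at_right_real]) (rule eventually_conj)
    then obtain \<epsilon> where \<epsilon>: "0 < \<epsilon>" "\<epsilon> < \<rho>" and y\<epsilon>: "y < ?f \<epsilon>" by blast
    have mN: "(\<lambda>N. real (m N) / real N) \<longlonglongrightarrow> a"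
    proof (rule tendsto_sandwich)
      show "(\<lambda>N. a) \<longlonglongrightarrow> a" by simp
      have "(\<lambda>N. a + 1 / real N) \<longlonglongrightarrow> a + 0" by (intro tendsto_intros lim_const_over_n)
      then show "(\<lambda>N. a + 1 / real N) \<longlonglongrightarrow> a" by simp
      show "\<forall>\<^sub>F N in sequentially. a \<le> real (m N) / real N"
        using eventually_gt_at_top[of 0] by eventually_elim (use m_ge in \<open>simp add: field_simps\<close>)
      show "\<forall>\<^sub>F N in sequentially. real (m N) / real N \<le> a + 1 / real N"
        using eventually_gt_at_top[of 0] by eventually_elim (use m_le in \<open>simp add: field_simps\<close>)
    qed
    have lnN: "(\<lambda>N. ln (real N) / real N) \<longlonglongrightarrow> 0" by (rule lim_ln_over_n)
    have inv: "(\<lambda>N. 1 / real N) \<longlonglongrightarrow> 0" by (rule lim_const_over_n)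
    \<comment> \<open>the logarithm of the lower bound, divided by N, in terms of quantities whose limits are known\<close>
    define g where "g N = ln (1 / 2) * (1 / real N) - (\<rho> + \<epsilon>)
        + real (m N) / real N * (ln ((\<rho> - \<epsilon>) / (real (m N) / real N)) + 1)
        - (1 / real N + (ln (real (m N) / real N) * (1 / real N) + ln (real N) / real N))" for N
    have "g \<longlonglongrightarrow> ln (1 / 2) * 0 - (\<rho> + \<epsilon>) + a * (ln ((\<rho> - \<epsilon>) / a) + 1) - (0 + (ln a * 0 + 0))"
      unfolding g_def using a0 \<epsilon> by (intro tendsto_intros mN lnN inv) auto
    then have "\<forall>\<^sub>F N in sequentially. y < g N" using y\<epsilon> by (intro order_tendstoD) auto
    moreover have "\<forall>\<^sub>F N in sequentially. \<delta> * real N powr (- \<alpha>) * c * v\<^sub>\<Lambda> / \<epsilon>\<^sup>2 \<le> 1 / 2"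
    proof -
      have "(\<lambda>N. \<delta> * real N powr (- \<alpha>) * c * v\<^sub>\<Lambda> / \<epsilon>\<^sup>2) \<longlonglongrightarrow> \<delta> * 0 * c * v\<^sub>\<Lambda> / \<epsilon>\<^sup>2"
        using \<alpha> \<epsilon> by (intro tendsto_intros tendsto_neg_powr filterlim_real_sequentially) auto
      then have "\<forall>\<^sub>F N in sequentially. \<delta> * real N powr (- \<alpha>) * c * v\<^sub>\<Lambda> / \<epsilon>\<^sup>2 < 1 / 2"
        by (intro order_tendstoD) auto
      then show ?thesis by eventually_elim simp
    qed
    ultimately show ?thesis
      using eventually_ge_at_top[of 1]
    proof eventually_elim
      case (elim N)
      then have N: "1 \<le> N" "0 < real N" by auto
      have "0 < a * real N" using a0 N by simp
      with m_ge[of N] have m0: "0 < real (m N)" by linarith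
      then have m1: "1 \<le> m N" by simp
      let ?F = "exp 1 * real (m N) * (real (m N) / exp 1) ^ m N"
      let ?A = "exp (- (real N * (\<rho> + \<epsilon>))) * (real N * (\<rho> - \<epsilon>)) ^ m N"
      have "1 / 2 * (?A / ?F) \<le> 1 / 2 * (?A / fact (m N))"
        using fact_upper_bound[OF m1] \<epsilon> N m0 by (intro mult_left_mono divide_left_mono) (auto intro!: mult_pos_pos)
      also have "\<dots> \<le> p N"
        unfolding p_eq[OF N(1)]
        using mixed_poisson_lower_bound[of "n N" "w N" "\<delta> * real N powr (- \<alpha>)" "real N" "X N" \<rho> \<epsilon> "m N",
            OF w[OF N(1)] N(2) X[OF N(1)]] elim(2) \<epsilon> w_sum[OF N(1)] \<rho> by simp
      finally have le: "1 / 2 * (?A / ?F) \<le> p N" .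
      have pos: "0 < 1 / 2 * (?A / ?F)"
        using m0 N \<epsilon> by (intro mult_pos_pos divide_pos_pos zero_less_power) auto
      then have p0: "0 < p N" using le by linarith
      have "ln (1 / 2 * (?A / ?F)) \<le> ln (p N)"
        using le pos p0 by (simp only: ln_le_cancel_iff)
      moreover have "ln (1 / 2 * (?A / ?F)) = real N * g N"
      proof -
        have "ln (1 / 2 * (?A / ?F)) = ln (1 / 2) + (- (real N * (\<rho> + \<epsilon>)) + real (m N) * ln (real N * (\<rho> - \<epsilon>)))
            - (1 + ln (real (m N)) + real (m N) * (ln (real (m N)) - 1))"
          using m0 N \<epsilon> by (simp add: ln_mult ln_div ln_realpow)
        also have "\<dots> = real N * g N"
          using m0 N \<epsilon> by (simp add: g_def ln_mult ln_div field_simps)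
        finally show ?thesis .
      qed
      ultimately have "g N \<le> 1 / real N * ln (p N)"
        using N by (simp add: field_simps)
      with elim(1) p0 show ?case by simp
    qed
  qed
  show ?thesis
    unfolding p_def[symmetric] I[symmetric]
  proof (rule order_tendstoI)
    fix y assume "y < - I"
    from lower[OF this] show "\<forall>\<^sub>F N in sequentially. y < 1 / real N * ln (p N)"
      by eventually_elim simp
  next
    fix y assume y: "- I < y"
    \<comment> \<open>decay of the truncation error strictly faster than the rate I\<close>
    define \<eta> where "\<eta> = \<bar>I\<bar> + 1"
    define D where "D = expectation (\<lambda>\<omega>. exp (\<eta> * \<Lambda> \<omega> powr (1 / \<alpha>)))"
    define E where "E = s\<^sup>2 * \<delta> * c * expectation (\<lambda>\<omega>. (\<Lambda> \<omega>)\<^sup>2 * exp (s * \<delta> * \<Lambda> \<omega> powr (1 / \<alpha>)))"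
    have E0: "0 \<le> E"
      unfolding E_def using \<delta> c by (intro mult_nonneg_nonneg integral_nonneg_AE) auto
    have D0: "0 \<le> D" unfolding D_def by (intro integral_nonneg_AE) auto
    define u where "u N = ln 2 * (1 / real N) - I + E * real N powr (1 - \<alpha>)" for N
    have "u \<longlonglongrightarrow> ln 2 * 0 - I + E * 0"
      unfolding u_def using \<alpha>
      by (intro tendsto_intros tendsto_neg_powr filterlim_real_sequentially lim_const_over_n) auto
    then have "\<forall>\<^sub>F N in sequentially. u N < y" using y by (intro order_tendstoD) auto
    moreover have "\<forall>\<^sub>F N in sequentially. C * D * real N powr \<alpha> * exp (- real N) \<le> 1"
    proof -
      define k where "k = nat \<lceil>\<alpha>\<rceil>"
      have le: "\<bar>C\<bar> * D * (real N ^ k / exp (real N)) \<ge> C * D * real N powr \<alpha> * exp (- real N)" if "1 \<le> N" for N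
      proof -
        have "real N powr \<alpha> \<le> real N powr real k" using that by (intro powr_mono) (auto simp: k_def real_nat_ceiling_ge)
        also have "\<dots> = real N ^ k" using that by (simp add: powr_realpow)
        finally have "C * D * real N powr \<alpha> \<le> \<bar>C\<bar> * D * real N ^ k"
          using D0 by (intro mult_mono mult_right_mono) auto
        then have "C * D * real N powr \<alpha> * exp (- real N) \<le> \<bar>C\<bar> * D * real N ^ k * exp (- real N)"
          by (intro mult_right_mono) auto
        then show ?thesis by (simp add: exp_minus divide_inverse mult.assoc)
      qed
      have "\<forall>\<^sub>F N in sequentially. \<bar>C\<bar> * D * (real N ^ k / exp (real N)) < 1"
      proof -
        have "(\<lambda>N. real N ^ k / exp (real N)) \<longlonglongrightarrow> 0"
          by (rule filterlim_compose[OF tendsto_power_div_exp_0 filterlim_real_sequentially])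
        then have "(\<lambda>N. \<bar>C\<bar> * D * (real N ^ k / exp (real N))) \<longlonglongrightarrow> \<bar>C\<bar> * D * 0"
          by (intro tendsto_intros)
        then show ?thesis by (intro order_tendstoD) auto
      qed
      then show ?thesis
        using eventually_ge_at_top[of 1]
      proof eventually_elim
        case (elim N)
        with le[OF elim(2)] show ?case by linarith
      qed
    qed
    moreover have "\<forall>\<^sub>F N in sequentially. 0 < p N"
      using lower[of "- I - 1"] by (auto elim: eventually_mono)
    ultimately show "\<forall>\<^sub>F N in sequentially. 1 / real N * ln (p N) < y"
      using eventually_ge_at_top[of 1]
    proof eventually_elim
      case (elim N)
      then have N: "1 \<le> N" "0 < real N" by auto
      have "p N \<le> real (n N) * D * exp (- \<eta> * real N)
        + exp (- \<theta> * real (m N) + s * real N * c * m\<^sub>\<Lambda> + E * real N powr (2 - \<alpha>))"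
        unfolding p_eq[OF N(1)]
        using mixed_poisson_upper_bound[of "n N" "w N" \<delta> "real N" \<eta> \<theta> "X N" "m N",
            OF w[OF N(1)] N(2) _ _ \<theta> X[OF N(1)]] \<delta>
        by (simp add: w_sum[OF N(1)] D_def E_def s_def \<eta>_def mult_ac)
      also have "\<dots> \<le> exp (- I * real N) * exp (E * real N powr (2 - \<alpha>))
        + exp (- I * real N) * exp (E * real N powr (2 - \<alpha>))"
      proof (rule add_mono)
        have C0: "0 \<le> C * real N powr \<alpha>" using n[OF N(1)] by (rule order.trans[rotated]) simp
        have "real (n N) * D * exp (- \<eta> * real N) \<le> (C * real N powr \<alpha>) * D * (exp (- I * real N) * exp (- real N))"
        proof (intro mult_mono n N D0)
          have "(I + 1) * real N \<le> \<eta> * real N" by (intro mult_right_mono) (auto simp: \<eta>_def)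
          then show "exp (- \<eta> * real N) \<le> exp (- I * real N) * exp (- real N)"
            by (simp add: exp_add[symmetric] algebra_simps)
        qed (use C0 D0 in auto)
        also have "\<dots> = exp (- I * real N) * (C * D * real N powr \<alpha> * exp (- real N))" by simp
        also have "\<dots> \<le> exp (- I * real N) * 1" using elim by (intro mult_left_mono) auto
        also have "\<dots> \<le> exp (- I * real N) * exp (E * real N powr (2 - \<alpha>))"
          using E0 by (intro mult_left_mono) auto
        finally show "real (n N) * D * exp (- \<eta> * real N) \<le> exp (- I * real N) * exp (E * real N powr (2 - \<alpha>))" .
        have "\<theta> * (a * real N) \<le> \<theta> * real (m N)" using \<theta> m_ge by (intro mult_left_mono) auto
        moreover have "- I * real N = - (\<theta> * (a * real N)) + s * real N * c * m\<^sub>\<Lambda>"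
          by (simp add: I_def \<rho> algebra_simps)
        ultimately show "exp (- \<theta> * real (m N) + s * real N * c * m\<^sub>\<Lambda> + E * real N powr (2 - \<alpha>))
          \<le> exp (- I * real N) * exp (E * real N powr (2 - \<alpha>))"
          by (simp only: exp_add[symmetric] exp_le_cancel_iff)
      qed
      also have "\<dots> = exp (real N * u N)"
      proof -
        have "real N powr (2 - \<alpha>) = real N * real N powr (1 - \<alpha>)"
          using N powr_add[of "real N" 1 "1 - \<alpha>"] by simp
        then have "real N * u N = ln 2 + (- I * real N + E * real N powr (2 - \<alpha>))"
          using N by (simp add: u_def algebra_simps)
        then show ?thesis by (simp only: exp_add) simp
      qed
      finally have "ln (p N) \<le> real N * u N" using elim by (metis ln_exp ln_le_cancel_iff exp_gt_zero)
      then have "1 / real N * ln (p N) \<le> u N" using N by (simp add: field_simps)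
      with elim show ?case by simp
    qed
  qed
qed

end

section \<open>The queue in a random environment\<close>

text \<open>The queue length is a function of the pair of environment and marked gaps, which are independent. By
Fubini its law is therefore the environment average of the Poisson laws found for a fixed environment.

Absolute values make the integrand well behaved for every sequence and not only for nonnegative ones, so
that it is measurable on the whole product space.\<close>

abbreviation sample_space :: "((nat \<Rightarrow> real) \<times> (nat \<Rightarrow> real \<times> real)) measure" where
  "sample_space \<equiv> PiM UNIV (\<lambda>_. borel) \<Otimes>\<^sub>M PiM UNIV (\<lambda>_. borel \<Otimes>\<^sub>M borel)"

abbreviation abs_queue_length ::
  "real \<Rightarrow> real \<Rightarrow> nat \<Rightarrow> real \<Rightarrow> (nat \<Rightarrow> real) \<Rightarrow> (nat \<Rightarrow> real \<times> real) \<Rightarrow> nat" where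
  "abs_queue_length \<Delta> \<alpha> N t lam z \<equiv>
     queue_length (\<lambda>s. real N * resampled_rate \<Delta> \<alpha> N (\<lambda>j. \<bar>lam j\<bar>) s) (\<lambda>i. fst (z i)) (\<lambda>i. snd (z i)) t"

text \<open>The arrival times are measurable also where the clock stays bounded: there they take the fixed value of
the infimum of the empty set, and whether this happens is decided at integer times.\<close>

lemma abs_queue_length_measurable:
  assumes h: "0 < h" "h = \<Delta> * real N powr (- \<alpha>)"
  shows "(\<lambda>p. abs_queue_length \<Delta> \<alpha> N t (fst p) (snd p)) \<in> sample_space \<rightarrow>\<^sub>M count_space UNIV"
proof -
  let ?R = "\<lambda>p. resampled_clock \<Delta> \<alpha> N (\<lambda>j. \<bar>fst p j\<bar>)"
  let ?G = "\<lambda>p i. \<Sum>k\<le>i. fst (snd p k)"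
  have R [measurable]: "(\<lambda>p. ?R p s) \<in> borel_measurable sample_space" if "0 \<le> s" for s
  proof -
    obtain n where n: "s < real n * h" using reals_Archimedean3[OF h(1)] by blast
    have "?R p s = (\<Sum>j<n. (real N * \<bar>fst p j\<bar>) * max 0 (min s ((real j + 1) * h) - real j * h))" for p :: "(nat \<Rightarrow> real) \<times> (nat \<Rightarrow> real \<times> real)"
      using resampled_rate_clock[OF h that n] by (simp add: resampled_clock_def clock_def)
    then show ?thesis by simp
  qed
  have G [measurable]: "(\<lambda>p. ?G p i) \<in> borel_measurable sample_space" for i by measurable
  have clock: "arrival_clock (?R p)" for p :: "(nat \<Rightarrow> real) \<times> (nat \<Rightarrow> real \<times> real)"
    using resampled_arrival_clock[OF h, of "\<lambda>j. \<bar>fst p j\<bar>"] by simp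
  let ?a = "\<lambda>p i. arrival_clock.A (?R p) (?G p i)"
  have a [measurable]: "(\<lambda>p. ?a p i) \<in> borel_measurable sample_space" for i
  proof (rule borel_measurableI_le)
    fix x :: real
    have iff: "?a p i \<le> x \<longleftrightarrow>
      (if \<exists>m::nat. ?G p i \<le> ?R p (real m) then 0 \<le> x \<and> ?G p i \<le> ?R p (max 0 x) else Inf {} \<le> x)"
      for p :: "(nat \<Rightarrow> real) \<times> (nat \<Rightarrow> real \<times> real)"
    proof -
      interpret arrival_clock "?R p" by (rule clock)
      show ?thesis
      proof (cases "\<exists>s\<ge>0. ?G p i \<le> ?R p s")
        case True
        then obtain s where s: "0 \<le> s" "?G p i \<le> ?R p s" by blast
        obtain m where "s \<le> real m" using real_arch_simple by blast
        then have "?R p s \<le> ?R p (real m)" using s by (intro mono_onD[OF R_mono]) auto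
        then have "\<exists>m::nat. ?G p i \<le> ?R p (real m)" using s by (intro exI[of _ m]) simp
        then show ?thesis using A_le_iff[OF s, of x] by auto
      next
        case False
        then have empty: "{s. 0 \<le> s \<and> ?G p i \<le> ?R p s} = {}" by blast
        have "?a p i = Inf {}" unfolding A_def empty ..
        moreover have "\<not> (\<exists>m::nat. ?G p i \<le> ?R p (real m))" using False of_nat_0_le_iff by blast
        ultimately show ?thesis by simp
      qed
    qed
    show "{p \<in> space sample_space. ?a p i \<le> x} \<in> sets sample_space"
      unfolding iff by measurable
  qed
  have "{i. arrival_time (\<lambda>s. real N * resampled_rate \<Delta> \<alpha> N (\<lambda>j. \<bar>fst p j\<bar>) s) (\<lambda>i. fst (snd p i)) i \<le> t \<and>
      t < arrival_time (\<lambda>s. real N * resampled_rate \<Delta> \<alpha> N (\<lambda>j. \<bar>fst p j\<bar>) s) (\<lambda>i. fst (snd p i)) i + snd (snd p i)}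
    = {i. ?a p i \<le> t \<and> t < ?a p i + snd (snd p i)}" for p :: "(nat \<Rightarrow> real) \<times> (nat \<Rightarrow> real \<times> real)"
    by (simp only: arrival_time_eq[OF clock])
  then show ?thesis unfolding queue_length_def by simp
qed

context prob_space begin

lemma environment_service_law:
  fixes L :: "nat \<Rightarrow> 'a \<Rightarrow> real" and \<xi> S :: "nat \<Rightarrow> 'a \<Rightarrow> real"
  assumes ind: "indep_vars (\<lambda>_. borel) (case_sum L (case_sum \<xi> S)) (UNIV :: (nat + nat + nat) set)"
    and \<xi>: "\<And>i. distributed M lborel (\<xi> i) f" and S: "\<And>i. distributed M lborel (S i) g"
  shows "indep_vars (\<lambda>_. borel) L UNIV"
    and "distr M sample_space (\<lambda>\<omega>. (\<lambda>j. L j \<omega>, \<lambda>i. (\<xi> i \<omega>, S i \<omega>)))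
      = distr M (PiM UNIV (\<lambda>_. borel)) (\<lambda>\<omega> j. L j \<omega>)
        \<Otimes>\<^sub>M distr M (PiM UNIV (\<lambda>_. borel \<Otimes>\<^sub>M borel)) (\<lambda>\<omega> i. (\<xi> i \<omega>, S i \<omega>))"
    and "distr M (PiM UNIV (\<lambda>_. borel \<Otimes>\<^sub>M borel)) (\<lambda>\<omega> i. (\<xi> i \<omega>, S i \<omega>))
      = PiM UNIV (\<lambda>_. density lborel f \<Otimes>\<^sub>M density lborel g)"
proof -
  let ?X = "case_sum L (case_sum \<xi> S)"
  have X [measurable]: "?X k \<in> borel_measurable M" for k using ind by (auto simp: indep_vars_def)
  have L [measurable]: "L j \<in> borel_measurable M" for j using X[of "Inl j"] by simp
  have \<xi>m [measurable]: "\<xi> j \<in> borel_measurable M" for j using X[of "Inr (Inl j)"] by simp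
  have Sm [measurable]: "S j \<in> borel_measurable M" for j using X[of "Inr (Inr j)"] by simp
  have "indep_vars (\<lambda>j. PiM {Inl j} (\<lambda>_. borel)) (\<lambda>j \<omega>. restrict (\<lambda>k. ?X k \<omega>) {Inl j}) (UNIV :: nat set)"
    by (rule indep_vars_restrict[OF ind]) (auto simp: disjoint_family_on_def)
  from indep_vars_compose2[OF this, of "\<lambda>j x. x (Inl j)" "\<lambda>_. borel"]
  show "indep_vars (\<lambda>_. borel) L UNIV" by simp
  show "distr M sample_space (\<lambda>\<omega>. (\<lambda>j. L j \<omega>, \<lambda>i. (\<xi> i \<omega>, S i \<omega>)))
      = distr M (PiM UNIV (\<lambda>_. borel)) (\<lambda>\<omega> j. L j \<omega>)
        \<Otimes>\<^sub>M distr M (PiM UNIV (\<lambda>_. borel \<Otimes>\<^sub>M borel)) (\<lambda>\<omega> i. (\<xi> i \<omega>, S i \<omega>))"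
  proof -
    let ?M1 = "PiM (range Inl) (\<lambda>_::nat + nat + nat. borel :: real measure)"
    let ?M2 = "PiM (range Inr) (\<lambda>_::nat + nat + nat. borel :: real measure)"
    let ?X1 = "\<lambda>\<omega>. restrict (\<lambda>k. ?X k \<omega>) (range Inl)" and ?X2 = "\<lambda>\<omega>. restrict (\<lambda>k. ?X k \<omega>) (range Inr)"
    let ?f1 = "\<lambda>x (j::nat). x (Inl j) :: real" and ?f2 = "\<lambda>x (i::nat). (x (Inr (Inl i)), x (Inr (Inr i))) :: real \<times> real"
    have ind12: "indep_var ?M1 ?X1 ?M2 ?X2"
      by (rule indep_var_restrict[OF ind]) auto
    then have X1 [measurable]: "?X1 \<in> M \<rightarrow>\<^sub>M ?M1" and X2 [measurable]: "?X2 \<in> M \<rightarrow>\<^sub>M ?M2"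
      and prod: "distr M ?M1 ?X1 \<Otimes>\<^sub>M distr M ?M2 ?X2 = distr M (?M1 \<Otimes>\<^sub>M ?M2) (\<lambda>\<omega>. (?X1 \<omega>, ?X2 \<omega>))"
      unfolding indep_var_distribution_eq by auto
    have f1 [measurable]: "?f1 \<in> ?M1 \<rightarrow>\<^sub>M PiM UNIV (\<lambda>_. borel)"
      by (intro measurable_PiM_single') (auto intro!: measurable_component_singleton)
    have f2 [measurable]: "?f2 \<in> ?M2 \<rightarrow>\<^sub>M PiM UNIV (\<lambda>_. borel \<Otimes>\<^sub>M borel)"
      by (intro measurable_PiM_single')
         (auto intro!: measurable_Pair measurable_component_singleton simp: space_pair_measure)
    interpret D2: prob_space "distr (distr M ?M2 ?X2) (PiM UNIV (\<lambda>_. borel \<Otimes>\<^sub>M borel)) ?f2"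
      by (intro prob_space.prob_space_distr prob_space_distr X2) simp
    have "distr (distr M ?M1 ?X1) (PiM UNIV (\<lambda>_. borel)) ?f1
        \<Otimes>\<^sub>M distr (distr M ?M2 ?X2) (PiM UNIV (\<lambda>_. borel \<Otimes>\<^sub>M borel)) ?f2
      = distr (distr M ?M1 ?X1 \<Otimes>\<^sub>M distr M ?M2 ?X2) sample_space (\<lambda>(x, y). (?f1 x, ?f2 y))"
      by (intro pair_measure_distr) (simp_all add: D2.sigma_finite_measure_axioms)
    also have "\<dots> = distr M sample_space (\<lambda>\<omega>. (?f1 (?X1 \<omega>), ?f2 (?X2 \<omega>)))"
      unfolding prod by (subst distr_distr) (simp_all add: o_def)
    finally show ?thesis
      by (simp add: distr_distr o_def)
  qed
  have pair_ind: "indep_vars (\<lambda>_. borel \<Otimes>\<^sub>M borel) (\<lambda>i \<omega>. (\<xi> i \<omega>, S i \<omega>)) UNIV"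
  proof -
    have "indep_vars (\<lambda>i. PiM {Inr (Inl i), Inr (Inr i)} (\<lambda>_. borel))
       (\<lambda>i \<omega>. restrict (\<lambda>k. ?X k \<omega>) {Inr (Inl i), Inr (Inr i)}) (UNIV :: nat set)"
      by (rule indep_vars_restrict[OF ind]) (auto simp: disjoint_family_on_def)
    from indep_vars_compose2[OF this, of "\<lambda>i x. (x (Inr (Inl i)), x (Inr (Inr i)))" "\<lambda>_. borel \<Otimes>\<^sub>M borel"]
    show ?thesis by (auto intro!: measurable_Pair measurable_component_singleton)
  qed
  have pair_law: "distr M (borel \<Otimes>\<^sub>M borel) (\<lambda>\<omega>. (\<xi> i \<omega>, S i \<omega>)) = density lborel f \<Otimes>\<^sub>M density lborel g" for i
  proof -
    have "indep_var (PiM {Inr (Inl i)} (\<lambda>_. borel)) (\<lambda>\<omega>. restrict (\<lambda>k. ?X k \<omega>) {Inr (Inl i)})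
       (PiM {Inr (Inr i)} (\<lambda>_. borel)) (\<lambda>\<omega>. restrict (\<lambda>k. ?X k \<omega>) {Inr (Inr i)})"
      by (rule indep_var_restrict[OF ind]) auto
    from indep_var_compose[OF this, of "\<lambda>x. x (Inr (Inl i))" borel "\<lambda>x. x (Inr (Inr i))" borel]
    have "indep_var borel (\<xi> i) borel (S i)" by (simp add: o_def)
    then have "distr M (borel \<Otimes>\<^sub>M borel) (\<lambda>\<omega>. (\<xi> i \<omega>, S i \<omega>)) = distr M borel (\<xi> i) \<Otimes>\<^sub>M distr M borel (S i)"
      unfolding indep_var_distribution_eq by simp
    also have "distr M borel (\<xi> i) = density lborel f"
      using distributed_distr_eq_density[OF \<xi>[of i]] by (simp cong: distr_cong)
    also have "distr M borel (S i) = density lborel g"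
      using distributed_distr_eq_density[OF S[of i]] by (simp cong: distr_cong)
    finally show ?thesis .
  qed
  show "distr M (PiM UNIV (\<lambda>_. borel \<Otimes>\<^sub>M borel)) (\<lambda>\<omega> i. (\<xi> i \<omega>, S i \<omega>))
      = PiM UNIV (\<lambda>_. density lborel f \<Otimes>\<^sub>M density lborel g)"
    using pair_ind by (subst (asm) indep_vars_iff_distr_eq_PiM) (auto simp: pair_law restrict_UNIV)
qed

end

context resampled_environment begin

text \<open>Laplace transform: the sum of \<open>n\<close> values stays below \<open>y\<close> with probability at most \<open>e^y q^n\<close>, where
\<open>q = E e^{-\<Lambda>} < 1\<close>.\<close>

lemma unbounded_sums:
  assumes pos: "AE \<omega> in M. \<Lambda> \<omega> \<noteq> 0"
  shows "AE \<omega> in M. \<forall>y. \<exists>n. y \<le> (\<Sum>j<n. L j \<omega>)"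
proof -
  define q where "q = expectation (\<lambda>\<omega>. exp (- \<Lambda> \<omega>))"
  have iq: "integrable M (\<lambda>\<omega>. exp (- \<Lambda> \<omega>))"
    by (rule integrable_const_bound[of _ 1]) (auto intro!: AE_I2 simp: \<Lambda>_nonneg)
  have q0: "0 \<le> q" unfolding q_def by (intro integral_nonneg_AE) auto
  have q1: "q < 1"
  proof -
    have "expectation (\<lambda>\<omega>. exp (- \<Lambda> \<omega>)) < expectation (\<lambda>\<omega>. 1)"
    proof (rule integral_less_AE_space)
      show "AE \<omega> in M. exp (- \<Lambda> \<omega>) < 1"
        using pos AE_space by eventually_elim (use \<Lambda>_nonneg in force)
    qed (auto simp: iq emeasure_space_1)
    then show ?thesis by (simp add: q_def prob_space)
  qed
  have bound: "prob {\<omega> \<in> space M. \<forall>n. (\<Sum>j<n. L j \<omega>) < y} \<le> exp y * q ^ n" for y n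
  proof -
    let ?X = "\<lambda>j \<omega>. exp (- L j \<omega>)"
    have i: "integrable M (?X j)" for j
      using L_integrable_iff[of "\<lambda>x. exp (- x)" j] iq by simp
    have ind: "indep_vars (\<lambda>_. borel) ?X {..<n}"
      by (rule indep_vars_compose2[OF indep_vars_subset[OF L_indep]]) auto
    have e: "expectation (\<lambda>\<omega>. \<Prod>j<n. ?X j \<omega>) = q ^ n" "integrable M (\<lambda>\<omega>. \<Prod>j<n. ?X j \<omega>)"
      using indep_vars_lebesgue_integral[OF _ ind i] indep_vars_integrable[OF _ ind i]
        L_expectation[of "\<lambda>x. exp (- x)"] by (auto simp: q_def)
    have "prob {\<omega> \<in> space M. \<forall>n. (\<Sum>j<n. L j \<omega>) < y}
        = expectation (indicator {\<omega> \<in> space M. \<forall>n. (\<Sum>j<n. L j \<omega>) < y})" by simp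
    also have "\<dots> \<le> expectation (\<lambda>\<omega>. exp y * (\<Prod>j<n. ?X j \<omega>))"
    proof (rule integral_mono)
      show "integrable M (indicator {\<omega> \<in> space M. \<forall>n. (\<Sum>j<n. L j \<omega>) < y} :: 'a \<Rightarrow> real)"
        by (simp add: integrable_indicator_iff emeasure_eq_measure)
      show "integrable M (\<lambda>\<omega>. exp y * (\<Prod>j<n. ?X j \<omega>))" using e by simp
      fix \<omega>
      have "(\<Prod>j<n. ?X j \<omega>) = exp (- (\<Sum>j<n. L j \<omega>))"
        by (simp add: exp_sum[symmetric] sum_negf)
      then have "exp y * (\<Prod>j<n. ?X j \<omega>) = exp (y - (\<Sum>j<n. L j \<omega>))"
        by (simp add: exp_add[symmetric])
      then show "indicator {\<omega> \<in> space M. \<forall>n. (\<Sum>j<n. L j \<omega>) < y} \<omega> \<le> exp y * (\<Prod>j<n. ?X j \<omega>)"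
        by (auto simp: indicator_def less_imp_le)
    qed
    also have "\<dots> = exp y * q ^ n" using e by simp
    finally show ?thesis .
  qed
  have "AE \<omega> in M. \<exists>n. real k \<le> (\<Sum>j<n. L j \<omega>)" for k
  proof -
    have lim: "(\<lambda>n. exp (real k) * q ^ n) \<longlonglongrightarrow> exp (real k) * 0"
      using q0 q1 by (intro tendsto_intros LIMSEQ_power_zero) auto
    have "prob {\<omega> \<in> space M. \<forall>n. (\<Sum>j<n. L j \<omega>) < real k} \<le> exp (real k) * 0"
      by (rule LIMSEQ_le_const[OF lim]) (use bound[of "real k"] in blast)
    then have "prob {\<omega> \<in> space M. \<not> (\<exists>n. real k \<le> (\<Sum>j<n. L j \<omega>))} = 0"
      by (simp add: not_le measure_le_0_iff)
    then show ?thesis by (subst AE_iff_measurable[OF _ refl]) (auto simp: emeasure_eq_measure)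
  qed
  then have "AE \<omega> in M. \<forall>k. \<exists>n. real k \<le> (\<Sum>j<n. L j \<omega>)" by (simp add: AE_all_countable)
  then show ?thesis
  proof eventually_elim
    case (elim \<omega>)
    show ?case
    proof
      fix y obtain k where "y \<le> real k" using real_arch_simple by blast
      then show "\<exists>n. y \<le> (\<Sum>j<n. L j \<omega>)" using elim order.trans by blast
    qed
  qed
qed

lemma L_positive:
  assumes pos: "AE \<omega> in M. \<Lambda> \<omega> \<noteq> 0"
  shows "AE \<omega> in M. \<forall>j. 0 < L j \<omega>"
proof -
  have "AE x in distr M borel (L j). x \<noteq> 0" for j
    unfolding L_distr using pos by (subst AE_distr_iff) auto
  then have "AE \<omega> in M. L j \<omega> \<noteq> 0" for j
    by (subst (asm) AE_distr_iff) auto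
  then have "AE \<omega> in M. \<forall>j. L j \<omega> \<noteq> 0" by (simp add: AE_all_countable)
  then show ?thesis using AE_space
    by eventually_elim (use L_nonneg in \<open>force simp: less_le\<close>)
qed

theorem queue_length_mixed_poisson:
  fixes \<mu> t :: real
  assumes ind: "indep_vars (\<lambda>_. borel) (case_sum L (case_sum \<xi> S)) (UNIV :: (nat + nat + nat) set)"
    and \<xi>: "\<And>i. distributed M lborel (\<xi> i) (exponential_density 1)"
    and S: "\<And>i. distributed M lborel (S i) (exponential_density \<mu>)"
    and h: "0 < h" "h = \<Delta> * real N powr (- \<alpha>)" and N: "1 \<le> N" and \<mu>: "0 < \<mu>" and t: "0 \<le> t" "t < real n * h"
    and pos: "AE \<omega> in M. \<Lambda> \<omega> \<noteq> 0"
  shows "mixed_poisson M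
    (\<lambda>\<omega>. queue_length (\<lambda>s. real N * resampled_rate \<Delta> \<alpha> N (\<lambda>j. L j \<omega>) s) (\<lambda>i. \<xi> i \<omega>) (\<lambda>i. S i \<omega>) t)
    (\<lambda>\<omega>. real N * (\<Sum>j<n. slot_weight h t (\<lambda>s. exp (- \<mu> * (t - s))) j * L j \<omega>))"
    (is "mixed_poisson M ?X ?K")
proof -
  let ?F = "\<lambda>p. abs_queue_length \<Delta> \<alpha> N t (fst p) (snd p)"
  let ?J = "\<lambda>\<omega>. (\<lambda>j. L j \<omega>, \<lambda>i. (\<xi> i \<omega>, S i \<omega>))"
  let ?Z = "PiM (UNIV :: nat set)
    (\<lambda>_. density lborel (exponential_density 1) \<Otimes>\<^sub>M density lborel (exponential_density \<mu>))"
  let ?LL = "distr M (PiM UNIV (\<lambda>_. borel)) (\<lambda>\<omega> j. L j \<omega>)"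
  note F = abs_queue_length_measurable[OF h, of t]
  have [measurable]: "\<xi> i \<in> borel_measurable M" "S i \<in> borel_measurable M" for i
    using \<xi>[of i] S[of i] by (auto simp: distributed_def)
  have L [measurable]: "(\<lambda>\<omega> j. L j \<omega>) \<in> M \<rightarrow>\<^sub>M PiM UNIV (\<lambda>_. borel)"
    by (intro measurable_PiM_single') auto
  have "(\<lambda>\<omega> i. (\<xi> i \<omega>, S i \<omega>)) \<in> M \<rightarrow>\<^sub>M PiM UNIV (\<lambda>_. borel \<Otimes>\<^sub>M borel)"
    by (intro measurable_PiM_single') (auto simp: space_pair_measure)
  with L have J: "?J \<in> M \<rightarrow>\<^sub>M sample_space" by (rule measurable_Pair)
  have FJ: "?F (?J \<omega>) = ?X \<omega>" if "\<omega> \<in> space M" for \<omega>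
    using L_nonneg[OF that] by simp
  have X: "?X \<in> M \<rightarrow>\<^sub>M count_space UNIV"
    using measurable_compose[OF J F] by (subst measurable_cong[OF FJ[symmetric]]) auto
  have law: "distr M sample_space ?J = ?LL \<Otimes>\<^sub>M ?Z"
    using environment_service_law(2,3)[OF ind \<xi> S] by simp
  have setsZ: "sets ?Z = sets (PiM UNIV (\<lambda>_. borel \<Otimes>\<^sub>M borel))"
    by (intro sets_PiM_cong sets_pair_measure_cong) auto
  interpret Z: prob_space ?Z
    by (intro prob_space_PiM prob_space_pair prob_space_exponential_density \<mu>) auto
  have K_meas [measurable]: "?K \<in> borel_measurable M" by measurable
  have K0: "0 \<le> ?K \<omega>" if "\<omega> \<in> space M" for \<omega>
    using L_nonneg[OF that] h t \<mu>
    by (intro mult_nonneg_nonneg sum_nonneg slot_weight_bounds(1) continuous_intros) auto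
  have prob: "prob {\<omega> \<in> space M. ?X \<omega> = k} = (LINT \<omega>|M. exp (- ?K \<omega>) * ?K \<omega> ^ k / fact k)" for k
  proof -
    let ?A = "{p \<in> space sample_space. ?F p = k}"
    have A: "?A \<in> sets sample_space"
      using measurable_sets[OF F, of "{k}"] by (simp add: vimage_def Int_def conj_commute)
    then have A': "?A \<in> sets (?LL \<Otimes>\<^sub>M ?Z)"
      unfolding law[symmetric] by simp
    have "emeasure M {\<omega> \<in> space M. ?X \<omega> = k} = emeasure M (?J -` ?A \<inter> space M)"
      using measurable_space[OF J] FJ by (intro arg_cong2[where f = emeasure] refl) auto
    also have "\<dots> = emeasure (?LL \<Otimes>\<^sub>M ?Z) ?A"
      unfolding law[symmetric] by (rule emeasure_distr[symmetric, OF J A])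
    also have "\<dots> = (\<integral>\<^sup>+ lam. emeasure ?Z (Pair lam -` ?A) \<partial>?LL)"
      by (rule Z.emeasure_pair_measure_alt[OF A'])
    also have "\<dots> = (\<integral>\<^sup>+ \<omega>. emeasure ?Z (Pair (\<lambda>j. L j \<omega>) -` ?A) \<partial>M)"
      using Z.measurable_emeasure_Pair[OF A'] by (subst nn_integral_distr[OF L]) simp_all
    also have "\<dots> = (\<integral>\<^sup>+ \<omega>. ennreal (exp (- ?K \<omega>) * ?K \<omega> ^ k / fact k) \<partial>M)"
    proof (rule nn_integral_cong_AE)
      show "AE \<omega> in M. emeasure ?Z (Pair (\<lambda>j. L j \<omega>) -` ?A) = ennreal (exp (- ?K \<omega>) * ?K \<omega> ^ k / fact k)"
        using L_positive[OF pos] unbounded_sums[OF pos]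
      proof eventually_elim
        case (elim \<omega>)
        have "Pair (\<lambda>j. L j \<omega>) -` ?A = {z \<in> space ?Z. queue_length (\<lambda>s. real N * resampled_rate \<Delta> \<alpha> N (\<lambda>j. L j \<omega>) s)
            (\<lambda>i. fst (z i)) (\<lambda>i. snd (z i)) t = k}"
          using elim(1) by (auto simp: space_pair_measure space_PiM less_imp_le)
        then show ?case
          using queue_length_poisson[OF h N \<mu> t, of "\<lambda>j. L j \<omega>" k] elim
          by (simp add: Z.emeasure_eq_measure)
      qed
    qed
    also have "\<dots> = ennreal (LINT \<omega>|M. exp (- ?K \<omega>) * ?K \<omega> ^ k / fact k)"
    proof (rule nn_integral_eq_integral)
      show "integrable M (\<lambda>\<omega>. exp (- ?K \<omega>) * ?K \<omega> ^ k / fact k)"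
      proof (rule integrable_const_bound[of _ 1])
        show "AE \<omega> in M. norm (exp (- ?K \<omega>) * ?K \<omega> ^ k / fact k) \<le> 1"
        proof (rule AE_I2)
          fix \<omega> assume \<omega>: "\<omega> \<in> space M"
          have "exp (- ?K \<omega>) * ?K \<omega> ^ k / fact k \<le> 1"
            using poisson_tail_bounds(2,3)[OF K0[OF \<omega>], of k] by (rule order.trans[rotated])
          moreover have "0 \<le> exp (- ?K \<omega>) * ?K \<omega> ^ k / fact k" using K0[OF \<omega>] by simp
          ultimately show "norm (exp (- ?K \<omega>) * ?K \<omega> ^ k / fact k) \<le> 1" by (simp only: real_norm_def abs_of_nonneg)
        qed
      qed measurable
      show "AE \<omega> in M. 0 \<le> exp (- ?K \<omega>) * ?K \<omega> ^ k / fact k"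
        using K0 by (intro AE_I2) simp
    qed
    finally show ?thesis
      using K0 by (simp add: measure_def integral_nonneg_AE AE_I2)
  qed
  show ?thesis unfolding mixed_poisson_def using X prob by blast
qed

section \<open>The limit theorem\<close>

text \<open>The common form of both limits: only the total weight \<open>c\<close> of \<open>f\<close> enters the rate, so that the weight
\<open>e^{-\<mu>(t-s)}\<close> of the queue and the weight \<open>e^{-\<mu>s}\<close> of \<^const>\<open>kappa\<close> lead to the same limit.\<close>

theorem slot_weight_ldp:
  fixes X :: "nat \<Rightarrow> 'a \<Rightarrow> nat" and f :: "real \<Rightarrow> real"
  assumes \<Delta>: "0 < \<Delta>" and t: "0 < t" and mpos: "0 < m\<^sub>\<Lambda>"
    and f: "continuous_on {0..t} f" "\<And>s. 0 \<le> s \<Longrightarrow> s \<le> t \<Longrightarrow> 0 \<le> f s \<and> f s \<le> 1"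
    and c: "(LBINT s:{0..t}. f s) = c" "0 < c"
    and X: "\<And>N n. 1 \<le> N \<Longrightarrow> t < real n * (\<Delta> * real N powr (- \<alpha>)) \<Longrightarrow> mixed_poisson M (X N)
        (\<lambda>\<omega>. real N * (\<Sum>j<n. slot_weight (\<Delta> * real N powr (- \<alpha>)) t f j * L j \<omega>))"
    and a: "c * m\<^sub>\<Lambda> < a"
  shows "(\<lambda>N. 1 / real N * ln (prob {\<omega> \<in> space M. a \<le> real (X N \<omega>) / real N}))
    \<longlonglongrightarrow> a * ln (c * m\<^sub>\<Lambda> / a) - c * m\<^sub>\<Lambda> + a"
proof -
  define h where "h N = \<Delta> * real N powr (- \<alpha>)" for N
  define n where "n N = Suc (nat \<lfloor>t / h N\<rfloor>)" for N
  have h: "0 < h N" if "1 \<le> N" for N using \<Delta> that by (simp add: h_def)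
  have n: "t < real (n N) * h N" if "1 \<le> N" for N
  proof -
    have "t / h N < real (n N)"
    proof -
      have "real (n N) = real_of_int \<lfloor>t / h N\<rfloor> + 1"
        using t h[OF that] by (simp add: n_def of_nat_nat)
      then show ?thesis by linarith
    qed
    then show ?thesis using h[OF that] by (simp add: pos_divide_less_eq)
  qed
  show ?thesis
  proof (rule mixed_poisson_ldp[OF \<Delta> c(2) mpos, where n = n and w = "\<lambda>N. slot_weight (h N) t f" and C = "t / \<Delta> + 1"])
    fix N :: nat assume N: "1 \<le> N"
    show "0 \<le> slot_weight (h N) t f j \<and> slot_weight (h N) t f j \<le> \<Delta> * real N powr (- \<alpha>)" for j
      using slot_weight_bounds[OF h[OF N] f, of j] by (simp add: h_def)
    show "(\<Sum>j<n N. slot_weight (h N) t f j) = c"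
      using slot_weight_sum[OF h[OF N] n[OF N] f(1)] c by simp
    show "mixed_poisson M (X N) (\<lambda>\<omega>. real N * (\<Sum>j<n N. slot_weight (h N) t f j * L j \<omega>))"
      using X[OF N n[OF N, unfolded h_def]] by (simp add: h_def)
    have "real (n N) \<le> t / h N + 1"
      using t h[OF N] by (simp add: n_def of_nat_nat)
    also have "t / h N = t / \<Delta> * real N powr \<alpha>"
      using \<Delta> N by (simp add: h_def powr_minus field_simps)
    also have "t / \<Delta> * real N powr \<alpha> + 1 \<le> (t / \<Delta> + 1) * real N powr \<alpha>"
      using N \<alpha> by (simp add: distrib_right ge_one_powr_ge_zero)
    finally show "real (n N) \<le> (t / \<Delta> + 1) * real N powr \<alpha>" .
  qed (use a in auto)
qed

end

lemma exponential_discount_integral: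
  fixes \<mu> t :: real
  assumes "0 < \<mu>" "0 \<le> t"
  shows "(LBINT s:{0..t}. exp (- \<mu> * s)) = (1 - exp (- \<mu> * t)) / \<mu>"
    and "(LBINT s:{0..t}. exp (- \<mu> * (t - s))) = (1 - exp (- \<mu> * t)) / \<mu>"
proof -
  have "(LBINT s:{0..t}. exp (- \<mu> * s)) = - exp (- \<mu> * t) / \<mu> - (- exp (- \<mu> * 0) / \<mu>)"
    unfolding set_lebesgue_integral_def real_scaleR_def
    using assms by (subst mult.commute, intro integral_FTC_Icc_real) (auto intro!: derivative_eq_intros)
  then show "(LBINT s:{0..t}. exp (- \<mu> * s)) = (1 - exp (- \<mu> * t)) / \<mu>"
    by (simp add: diff_divide_distrib)
  have "(LBINT s:{0..t}. exp (- \<mu> * (t - s))) = exp (- \<mu> * (t - t)) / \<mu> - exp (- \<mu> * (t - 0)) / \<mu>"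
    unfolding set_lebesgue_integral_def real_scaleR_def
    using assms by (subst mult.commute, intro integral_FTC_Icc_real) (auto intro!: derivative_eq_intros)
  then show "(LBINT s:{0..t}. exp (- \<mu> * (t - s))) = (1 - exp (- \<mu> * t)) / \<mu>"
    by (simp add: diff_divide_distrib)
qed

theorem mainTheorem3:
  fixes P :: "'a measure"
    and \<Lambda> :: "'a \<Rightarrow> real"
    and \<Lambda>s :: "nat \<Rightarrow> 'a \<Rightarrow> real"
    and \<xi> S :: "nat \<Rightarrow> nat \<Rightarrow> 'a \<Rightarrow> real"
    and \<Delta> \<mu> t \<alpha> a :: real
  assumes "prob_space P"
    and "0 < \<Delta>" and "0 < \<mu>" and "0 < t" and "1 < \<alpha>"
    and "\<And>\<omega>. \<omega> \<in> space P \<Longrightarrow> 0 \<le> \<Lambda> \<omega>"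
    and "\<exists>f. distributed P lborel \<Lambda> f"
    and "integrable P \<Lambda>" and "integrable P (\<lambda>\<omega>. (\<Lambda> \<omega>)\<^sup>2)"
    (* Not implied by two moments, but needed: for a polynomial tail a single slot makes the
       probability decay only polynomially in N.  A finite E exp (eta Lambda), eta > 0, suffices. *)
    and light_tail: "\<And>\<theta>. 0 < \<theta> \<Longrightarrow> integrable P (\<lambda>\<omega>. exp (\<theta> * \<Lambda> \<omega> powr (1 / \<alpha>)))"
    and "\<And>j. distr P borel (\<Lambda>s j) = distr P borel \<Lambda>"
    and "\<And>j \<omega>. \<omega> \<in> space P \<Longrightarrow> 0 \<le> \<Lambda>s j \<omega>"
    and "\<And>N i. distributed P lborel (\<xi> N i) (exponential_density 1)"
    and "\<And>N i. distributed P lborel (S N i) (exponential_density \<mu>)"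
    and "\<And>N. prob_space.indep_vars P (\<lambda>_. borel)
               (case_sum \<Lambda>s (case_sum (\<xi> N) (S N))) (UNIV :: (nat + nat + nat) set)"
    and "rho (prob_space.expectation P \<Lambda>) \<mu> t < a"
  defines "\<rho> \<equiv> rho (prob_space.expectation P \<Lambda>) \<mu> t"
    and "\<Lambda>N \<equiv> \<lambda>N \<omega>. resampled_rate \<Delta> \<alpha> N (\<lambda>j. \<Lambda>s j \<omega>)"
    and "Mq \<equiv> \<lambda>N \<omega>. queue_length (\<lambda>s. real N * resampled_rate \<Delta> \<alpha> N (\<lambda>j. \<Lambda>s j \<omega>) s)
                      (\<lambda>i. \<xi> N i \<omega>) (\<lambda>i. S N i \<omega>) t"
  shows
    "(\<lambda>N. 1 / real N * ln (\<P>(\<omega> in P. real (Mq N \<omega>) / real N \<ge> a)))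
       \<longlonglongrightarrow> a * ln (\<rho> / a) - \<rho> + a
     \<and> (\<forall>M :: nat \<Rightarrow> 'a \<Rightarrow> nat.
          (\<forall>N\<ge>1. mixed_poisson P (M N) (\<lambda>\<omega>. real N * kappa \<mu> t (\<Lambda>N N \<omega>))) \<longrightarrow>
          (\<lambda>N. 1 / real N * ln (\<P>(\<omega> in P. real (M N \<omega>) / real N \<ge> a)))
            \<longlonglongrightarrow> a * ln (\<rho> / a) - \<rho> + a)"
proof -
  interpret prob_space P by fact
  obtain f where f: "distributed P lborel \<Lambda> f" using assms(7) by blast
  have indL: "indep_vars (\<lambda>_. borel) \<Lambda>s UNIV"
    by (rule environment_service_law(1)[OF assms(15) assms(13) assms(14)])
  have meas: "\<Lambda> \<in> borel_measurable P" using f by (auto simp: distributed_def)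
  interpret resampled_environment P \<Lambda>s \<Lambda> \<alpha>
    by unfold_locales (use assms(5,6,8-12) meas indL in auto)
  have "AE x in distr P lborel \<Lambda>. x \<noteq> 0"
    unfolding distributed_distr_eq_density[OF f]
    using distributed_borel_measurable[OF f] AE_lborel_singleton[of 0] by (subst AE_density) auto
  then have pos: "AE \<omega> in P. \<Lambda> \<omega> \<noteq> 0"
    by (subst (asm) AE_distr_iff) (use meas in auto)
  have mpos: "0 < m\<^sub>\<Lambda>"
  proof -
    have "m\<^sub>\<Lambda> \<noteq> 0"
    proof
      assume "m\<^sub>\<Lambda> = 0"
      then have "AE \<omega> in P. \<Lambda> \<omega> = 0"
        using integral_nonneg_eq_0_iff_AE[OF assms(8)] assms(6) by (simp add: AE_I2)
      with pos have "AE \<omega> in P. False" by eventually_elim simp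
      then show False by simp
    qed
    moreover have "0 \<le> m\<^sub>\<Lambda>" using assms(6) by (intro integral_nonneg_AE AE_I2)
    ultimately show ?thesis by simp
  qed
  let ?c = "(1 - exp (- \<mu> * t)) / \<mu>"
  have c: "0 < ?c" using assms(3,4) by simp
  have \<rho>: "\<rho> = ?c * m\<^sub>\<Lambda>" by (simp add: \<rho>_def rho_def)
  have a: "?c * m\<^sub>\<Lambda> < a" using assms(16) \<rho> by (simp add: \<rho>_def)
  have h: "0 < \<Delta> * real N powr (- \<alpha>)" if "1 \<le> N" for N using assms(2) that by simp
  show ?thesis
  proof (intro conjI allI impI)
    show "(\<lambda>N. 1 / real N * ln (\<P>(\<omega> in P. real (Mq N \<omega>) / real N \<ge> a))) \<longlonglongrightarrow> a * ln (\<rho> / a) - \<rho> + a"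
      unfolding \<rho>
    proof (rule slot_weight_ldp[OF assms(2,4) mpos _ _ exponential_discount_integral(2) c _ a])
      fix N n :: nat assume N: "1 \<le> N" and n: "t < real n * (\<Delta> * real N powr (- \<alpha>))"
      show "mixed_poisson P (Mq N) (\<lambda>\<omega>. real N * (\<Sum>j<n. slot_weight (\<Delta> * real N powr (- \<alpha>)) t
          (\<lambda>s. exp (- \<mu> * (t - s))) j * \<Lambda>s j \<omega>))"
        unfolding Mq_def
        by (rule queue_length_mixed_poisson[OF assms(15,13,14) h[OF N] refl N assms(3) _ n pos])
           (use assms(4) in simp)
    qed (use assms(3,4) in \<open>auto intro!: continuous_intros\<close>)
  next
    fix M :: "nat \<Rightarrow> 'a \<Rightarrow> nat"
    assume M: "\<forall>N\<ge>1. mixed_poisson P (M N) (\<lambda>\<omega>. real N * kappa \<mu> t (\<Lambda>N N \<omega>))"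
    show "(\<lambda>N. 1 / real N * ln (\<P>(\<omega> in P. real (M N \<omega>) / real N \<ge> a))) \<longlonglongrightarrow> a * ln (\<rho> / a) - \<rho> + a"
      unfolding \<rho>
    proof (rule slot_weight_ldp[OF assms(2,4) mpos _ _ exponential_discount_integral(1) c _ a])
      fix N n :: nat assume N: "1 \<le> N" and n: "t < real n * (\<Delta> * real N powr (- \<alpha>))"
      have eq: "kappa \<mu> t (\<Lambda>N N \<omega>) = (\<Sum>j<n. slot_weight (\<Delta> * real N powr (- \<alpha>)) t (\<lambda>s. exp (- \<mu> * s)) j * \<Lambda>s j \<omega>)" for \<omega>
        unfolding kappa_def \<Lambda>N_def
        by (subst resampled_rate_integral(1)[OF h[OF N] refl n])
           (auto intro!: continuous_intros sum.cong)
      from M[rule_format, OF N]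
      show "mixed_poisson P (M N) (\<lambda>\<omega>. real N * (\<Sum>j<n. slot_weight (\<Delta> * real N powr (- \<alpha>)) t
          (\<lambda>s. exp (- \<mu> * s)) j * \<Lambda>s j \<omega>))"
        unfolding eq .
    qed (use assms(3,4) in \<open>auto intro!: continuous_intros\<close>)
  qed
qed

end
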